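(* Let $p>1$ be a given constant, and consider on $I=(-1,1)$ the nonlinear eigenvalue problem $$-\Vert u'\Vert^{p-1}u''(x)=\mu u(x)^p,\ x\in I,\qquad u(x)>0,\ x\in I,\qquad u(\pm1)=0,$$ with eigenvalue parameter $\mu>0$. Let $$\mu_1:=\inf\left\{\Vert u'\Vert^{p+1}:\ u\in H_0^1(I),\ \int_I|u(x)|^{p+1}\,dx=1\right\}$$ be its first eigenvalue, and let $\varphi_1$ be the first eigenfunction associated with $\mu_1$. Then $$\mu_1=2^{(p-3)/2}(p+1)A_p^{(p+3)/2}B_p^{(p-1)/2}.$$ Furthermore, $$\varphi_1(x)=2^{2/(p^2-1)}(p+1)^{-1/(p-1)}A_p^{-(p+3)/(p^2-1)}C_p^{-1/(p+1)}W_p(x).$$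
   Context: $I:=(-1,1)$ and $\Vert u'\Vert:=\left(\int_I u'(x)^2\,dx\right)^{1/2}$. The first eigenfunction $\varphi_1$ is the positive minimizer attaining the infimum $\mu_1$, normalized by $\int_I\varphi_1(x)^{p+1}dx=1$; it solves the eigenvalue problem with $\mu=\mu_1$. The constants are $$A_p:=\int_0^1\frac{1}{\sqrt{1-s^{p+1}}}\,ds,\qquad B_p:=\int_0^1\sqrt{1-s^{p+1}}\,ds,\qquad C_p:=\int_0^1\frac{s^{p+1}}{\sqrt{1-s^{p+1}}}\,ds.$$ $W_p$ denotes the unique solution (known to exist and be unique) of $-W''(x)=W(x)^p$ and $W(x)>0$ for $x\in I$, $W(-1)=W(1)=0$. *)

theory Defs
  imports "HOL-Analysis.Analysis"
begin

abbreviation interval_I :: "real set" where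
  "interval_I \<equiv> {-1<..<1}"

text \<open>Elements of the function spaces are represented by functions on the whole real line; only
  their values on the open interval enter the definitions below.\<close>

definition L2_I :: "(real \<Rightarrow> real) set" where
  "L2_I = {f. f \<in> borel_measurable (lebesgue_on interval_I) \<and>
              integrable (lebesgue_on interval_I) (\<lambda>x. (f x)\<^sup>2)}"

definition L2_norm_I :: "(real \<Rightarrow> real) \<Rightarrow> real" where
  "L2_norm_I f = sqrt (LINT x|lebesgue_on interval_I. (f x)\<^sup>2)"

text \<open>The test functions \<open>C\<^sub>c\<^sup>\<infinity>(I)\<close>, extended by zero.\<close>

definition test_functions_I :: "(real \<Rightarrow> real) set" where
  "test_functions_I = {\<phi>. (\<forall>n x. (deriv ^^ n) \<phi> differentiable at x) \<and>
     (\<exists>K. compact K \<and> K \<subseteq> interval_I \<and> (\<forall>x. x \<notin> K \<longrightarrow> \<phi> x = 0))}"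

text \<open>\<open>H1_deriv_I u g\<close>: \<open>u \<in> H\<^sup>1(I)\<close> with weak derivative \<open>g\<close>. It is a relation because
  \<open>g\<close> is determined only almost everywhere.\<close>

definition H1_deriv_I :: "(real \<Rightarrow> real) \<Rightarrow> (real \<Rightarrow> real) \<Rightarrow> bool" where
  "H1_deriv_I u g \<longleftrightarrow> u \<in> L2_I \<and> g \<in> L2_I \<and>
     (\<forall>\<phi>\<in>test_functions_I.
        (LINT x|lebesgue_on interval_I. u x * deriv \<phi> x) =
        - (LINT x|lebesgue_on interval_I. g x * \<phi> x))"

text \<open>\<open>H\<^sub>0\<^sup>1(I)\<close> is the closure of the test functions in the \<open>H\<^sup>1\<close> norm.\<close>

definition H01_I :: "(real \<Rightarrow> real) set" where
  "H01_I = {u. \<exists>g. H1_deriv_I u g \<and>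
     (\<exists>\<phi> :: nat \<Rightarrow> real \<Rightarrow> real. (\<forall>n. \<phi> n \<in> test_functions_I) \<and>
        (\<lambda>n. sqrt ((L2_norm_I (\<lambda>x. \<phi> n x - u x))\<^sup>2 +
                    (L2_norm_I (\<lambda>x. deriv (\<phi> n) x - g x))\<^sup>2)) \<longlonglongrightarrow> 0)}"

definition mu1 :: "real \<Rightarrow> real" where
  "mu1 p = Inf {L2_norm_I g powr (p + 1) | u g.
     u \<in> H01_I \<and> H1_deriv_I u g \<and>
     (LINT x|lebesgue_on interval_I. \<bar>u x\<bar> powr (p + 1)) = 1}"

text \<open>Solutions are classical: continuous up to the boundary and twice differentiable inside
  (both equations below then make the second derivative continuous).\<close>

definition positive_dirichlet :: "(real \<Rightarrow> real) \<Rightarrow> bool" where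
  "positive_dirichlet u \<longleftrightarrow>
     continuous_on {-1..1} u \<and>
     (\<forall>x\<in>interval_I. u differentiable at x \<and> deriv u differentiable at x) \<and>
     (\<forall>x\<in>interval_I. u x > 0) \<and> u (-1) = 0 \<and> u 1 = 0"

definition eigen_solution :: "real \<Rightarrow> real \<Rightarrow> (real \<Rightarrow> real) \<Rightarrow> bool" where
  "eigen_solution p \<mu> u \<longleftrightarrow>
     \<mu> > 0 \<and> positive_dirichlet u \<and> deriv u \<in> L2_I \<and>
     (\<forall>x\<in>interval_I. - (L2_norm_I (deriv u) powr (p - 1)) * deriv (deriv u) x = \<mu> * u x powr p)"

text \<open>The positive normalized minimizer attaining \<open>mu1 p\<close>, which solves the eigenvalue problem
  with this eigenvalue. Being classical, it has \<open>deriv \<phi>\<close> as its weak derivative.\<close>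

definition first_eigenfunction :: "real \<Rightarrow> (real \<Rightarrow> real) \<Rightarrow> bool" where
  "first_eigenfunction p \<phi> \<longleftrightarrow>
     \<phi> \<in> H01_I \<and>
     (LINT x|lebesgue_on interval_I. \<phi> x powr (p + 1)) = 1 \<and>
     L2_norm_I (deriv \<phi>) powr (p + 1) = mu1 p \<and>
     eigen_solution p (mu1 p) \<phi>"

definition W_solution :: "real \<Rightarrow> (real \<Rightarrow> real) \<Rightarrow> bool" where
  "W_solution p W \<longleftrightarrow>
     positive_dirichlet W \<and> (\<forall>x\<in>interval_I. - deriv (deriv W) x = W x powr p)"

definition A_const :: "real \<Rightarrow> real" where
  "A_const p = (LINT s|lebesgue_on {0<..<1}. 1 / sqrt (1 - s powr (p + 1)))"

definition B_const :: "real \<Rightarrow> real" where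
  "B_const p = (LINT s|lebesgue_on {0<..<1}. sqrt (1 - s powr (p + 1)))"

definition C_const :: "real \<Rightarrow> real" where
  "C_const p = (LINT s|lebesgue_on {0<..<1}. s powr (p + 1) / sqrt (1 - s powr (p + 1)))"

end

theory Submission
  imports Defs
begin

text \<open>
  Write \<open>r = p + 1\<close>, and \<open>A\<close>, \<open>B\<close> for the constants of the statement. Let \<open>v\<close> vanish at \<open>\<plusminus>1\<close>, with
  \<open>max \<bar>v\<bar> = v x0 = 1\<close>, and put \<open>h = sqrt (1 - \<bar>v\<bar> powr r)\<close>. Integrating \<open>(v' - A h)\<^sup>2 \<ge> 0\<close> to the left of
  \<open>x0\<close> and \<open>(v' + A h)\<^sup>2 \<ge> 0\<close> to the right of it gives
  \<open>\<integral>v'\<^sup>2 \<ge> 4 A B - A\<^sup>2 (2 - \<integral>\<bar>v\<bar> powr r)\<close>, because \<open>h v'\<close> is the derivative of a function of \<open>v\<close>. With the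
  identity \<open>r A = (r + 2) B\<close> and Young's inequality this becomes the sharp inequality between
  \<open>\<integral>v'\<^sup>2\<close> and \<open>\<integral>\<bar>v\<bar> powr r\<close>; Fatou's lemma carries it over to \<open>H\<^sub>0\<^sup>1\<close>. Equality holds for the profile
  \<open>w\<close> with \<open>\<integral>\<^sub>0\<^sup>w ds / sqrt (1 - s powr r) = A (1 - \<bar>x\<bar>)\<close>, and \<open>w'\<close> is a bounded pointwise limit of
  derivatives of test functions, so the constant is the infimum.

  By conservation of energy every positive solution of \<open>- u'' = l u powr p\<close> with zero boundary
  values is a multiple of \<open>w\<close>. The factor is given by \<open>l = 1\<close> for \<open>W\<close> and by the normalization for the
  first eigenfunction.
\<close>

section \<open>The constants\<close>

lemma
  fixes f :: "real \<Rightarrow> real"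
  assumes "f absolutely_integrable_on {a..b}"
  shows integrable_lebesgue_on_open_interval: "integrable (lebesgue_on {a<..<b}) f"
    and LINT_open_interval: "(LINT x|lebesgue_on {a<..<b}. f x) = integral {a..b} f"
proof -
  have "f absolutely_integrable_on {a<..<b}"
    by (rule set_integrable_subset[OF assms]) auto
  then show int: "integrable (lebesgue_on {a<..<b}) f"
    by (simp add: integrable_restrict_space set_integrable_def)
  have "(LINT x|lebesgue_on {a<..<b}. f x) = integral {a<..<b} f"
    by (rule lebesgue_integral_eq_integral[OF int]) auto
  then show "(LINT x|lebesgue_on {a<..<b}. f x) = integral {a..b} f"
    by (simp add: integral_open_interval_real)
qed

lemma
  fixes f :: "real \<Rightarrow> real"
  assumes "continuous_on {a..b} f"
  shows integrable_lebesgue_on_open_interval_continuous: "integrable (lebesgue_on {a<..<b}) f"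
    and LINT_open_interval_continuous: "(LINT x|lebesgue_on {a<..<b}. f x) = integral {a..b} f"
proof -
  have "f absolutely_integrable_on {a..b}"
    using assms absolutely_integrable_continuous_real by blast
  then show "integrable (lebesgue_on {a<..<b}) f"
    and "(LINT x|lebesgue_on {a<..<b}. f x) = integral {a..b} f"
    using integrable_lebesgue_on_open_interval LINT_open_interval by blast+
qed

lemma powr_less_one_base: "0 \<le> s \<Longrightarrow> s < 1 \<Longrightarrow> 0 < r \<Longrightarrow> s powr r < (1::real)"
  using powr_less_mono2[of r s 1] by simp

lemma powr_le_self: "0 \<le> s \<Longrightarrow> s \<le> 1 \<Longrightarrow> 1 \<le> r \<Longrightarrow> s powr r \<le> (s::real)"
  using powr_mono'[of 1 r s] by simp

lemma continuous_on_sqrt_one_minus_powr: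
  "0 < r \<Longrightarrow> continuous_on {0..b} (\<lambda>s::real. sqrt (1 - s powr r))"
  by (intro continuous_on_real_sqrt continuous_on_diff continuous_on_const continuous_on_powr'
      continuous_on_id) auto

text \<open>Supplies the integrable majorant for the singularity at 1. The antiderivative
  \<open>- 2 * sqrt (1 - s)\<close> is continuous up to 1, so the fundamental theorem needs a
  derivative only in the interior.\<close>

lemma has_integral_inverse_sqrt: "((\<lambda>s::real. 1 / sqrt (1 - s)) has_integral 2) {0..1}"
proof -
  have "((\<lambda>s. 1 / sqrt (1 - s)) has_integral (- 2 * sqrt (1 - 1) - (- 2 * sqrt (1 - 0)))) {0..(1::real)}"
    by (rule fundamental_theorem_of_calculus_interior)
      (auto intro!: continuous_intros derivative_eq_intros
        simp: has_real_derivative_iff_has_vector_derivative[symmetric] field_simps)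
  then show ?thesis by simp
qed

text \<open>For \<open>r \<ge> 1\<close> one has \<open>s powr r \<le> s\<close> on the unit
  interval, hence domination by \<open>1 / sqrt (1 - s)\<close>. At \<open>s = 1\<close> both
  functions are 0, because division by zero gives 0.\<close>

lemma arcsin_integrand_absolutely_integrable:
  assumes "r \<ge> (1::real)"
  shows "(\<lambda>s. 1 / sqrt (1 - s powr r)) absolutely_integrable_on {0..1}"
proof -
  let ?g = "\<lambda>s::real. 1 / sqrt (1 - s)"
  have g: "?g absolutely_integrable_on {0..1}"
    by (rule nonnegative_absolutely_integrable_1)
      (use has_integral_inverse_sqrt in \<open>auto simp: integrable_on_def\<close>)
  show ?thesis
  proof (rule measurable_bounded_by_integrable_imp_absolutely_integrable)
    have "(\<lambda>s. 1 / sqrt (1 - s powr r)) \<in> borel_measurable borel" by measurable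
    then show "(\<lambda>s. 1 / sqrt (1 - s powr r)) \<in> borel_measurable (lebesgue_on {0..1})"
      by (intro measurable_restrict_space1 measurable_completion) simp
    show "?g integrable_on {0..1}" using g set_lebesgue_integral_eq_integral(1) by blast
    show "norm (1 / sqrt (1 - s powr r)) \<le> ?g s" if "s \<in> {0..1}" for s
    proof (cases "s = 1")
      case False
      with that have "0 \<le> s" "s < 1" by auto
      then have "s powr r \<le> s" using powr_le_self assms by simp
      then show ?thesis using \<open>s < 1\<close> by (auto simp: frac_le)
    qed auto
  qed auto
qed

text \<open>A generalized arcsine: \<open>r = 2\<close> gives the usual one on the unit interval. It
  straightens out the equation \<open>w' = A * sqrt (1 - w powr r)\<close>, whose solutions it turns
  into linear functions.\<close>

definition gen_arcsin :: "real \<Rightarrow> real \<Rightarrow> real" where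
  "gen_arcsin r t = integral {0..t} (\<lambda>s. 1 / sqrt (1 - s powr r))"

definition area :: "real \<Rightarrow> real \<Rightarrow> real" where
  "area r t = integral {0..t} (\<lambda>s. sqrt (1 - s powr r))"

lemma gen_arcsin_0 [simp]: "gen_arcsin r 0 = 0"
  by (simp add: gen_arcsin_def)

lemma A_const_eq_gen_arcsin: "p > 1 \<Longrightarrow> A_const p = gen_arcsin (p + 1) 1"
  unfolding A_const_def gen_arcsin_def
  by (rule LINT_open_interval, rule arcsin_integrand_absolutely_integrable) simp

lemma B_const_eq_area: "p > 1 \<Longrightarrow> B_const p = area (p + 1) 1"
  unfolding B_const_def area_def
  by (rule LINT_open_interval_continuous, rule continuous_on_sqrt_one_minus_powr) simp

lemma continuous_on_gen_arcsin: "r \<ge> 1 \<Longrightarrow> continuous_on {0..1} (gen_arcsin r)"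
  unfolding gen_arcsin_def
  by (rule indefinite_integral_continuous_1)
    (use arcsin_integrand_absolutely_integrable set_lebesgue_integral_eq_integral(1) in blast)

lemma has_real_derivative_gen_arcsin:
  assumes "r \<ge> 1" "0 < t" "t < 1"
  shows "(gen_arcsin r has_real_derivative 1 / sqrt (1 - t powr r)) (at t)"
proof -
  \<comment> \<open>The midpoint of \<open>t\<close> and 1 keeps the integrand continuous on
    \<open>{0..b}\<close>, away from its singularity.\<close>
  define b where "b = (1 + t) / 2"
  have b: "t < b" "b < 1" "0 < b" using assms by (auto simp: b_def)
  have "((\<lambda>x. integral {0..x} (\<lambda>s. 1 / sqrt (1 - s powr r))) has_real_derivative
         1 / sqrt (1 - t powr r)) (at t within {0..b})"
  proof (rule integral_has_real_derivative)
    show "continuous_on {0..b} (\<lambda>s. 1 / sqrt (1 - s powr r))"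
    proof (rule continuous_on_divide[OF continuous_on_const])
      show "continuous_on {0..b} (\<lambda>s. sqrt (1 - s powr r))"
        using assms by (intro continuous_on_sqrt_one_minus_powr) auto
      show "\<forall>s\<in>{0..b}. sqrt (1 - s powr r) \<noteq> 0"
      proof
        fix s assume "s \<in> {0..b}"
        then have "s powr r < 1" using powr_less_one_base[of s r] b assms by auto
        then show "sqrt (1 - s powr r) \<noteq> 0" by simp
      qed
    qed
  qed (use assms b in auto)
  then show ?thesis
    using assms b unfolding gen_arcsin_def by (simp add: at_within_Icc_at)
qed

lemma gen_arcsin_strict_mono:
  assumes "r \<ge> 1" "0 \<le> s" "s < t" "t \<le> 1"
  shows "gen_arcsin r s < gen_arcsin r t"
proof (rule DERIV_pos_imp_increasing_open[OF \<open>s < t\<close>])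
  show "\<exists>y. (gen_arcsin r has_real_derivative y) (at x) \<and> 0 < y" if "s < x" "x < t" for x
    using has_real_derivative_gen_arcsin[of r x] powr_less_one_base[of x r] assms that
    by (intro exI[of _ "1 / sqrt (1 - x powr r)"]) auto
  show "continuous_on {s..t} (gen_arcsin r)"
    using continuous_on_gen_arcsin by (rule continuous_on_subset) (use assms in auto)
qed

lemma gen_arcsin_inj: "r \<ge> 1 \<Longrightarrow> inj_on (gen_arcsin r) {0..1}"
  by (rule linorder_inj_onI) (auto dest!: gen_arcsin_strict_mono[of r])

lemma area_has_real_derivative:
  assumes "r > 0" "0 < t" "t < 1"
  shows "(area r has_real_derivative sqrt (1 - t powr r)) (at t)"
proof -
  have "((\<lambda>x. integral {0..x} (\<lambda>s. sqrt (1 - s powr r))) has_real_derivative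
         sqrt (1 - t powr r)) (at t within {0..1})"
    by (rule integral_has_real_derivative[OF continuous_on_sqrt_one_minus_powr]) (use assms in auto)
  then show ?thesis
    using assms unfolding area_def by (simp add: at_within_Icc_at)
qed

lemma continuous_on_area: "r > 0 \<Longrightarrow> continuous_on {0..1} (area r)"
  unfolding area_def
  by (rule indefinite_integral_continuous_1) (auto intro!: integrable_continuous_real continuous_on_sqrt_one_minus_powr)

lemma gen_arcsin_1_pos: "r \<ge> 1 \<Longrightarrow> 0 < gen_arcsin r 1"
  using gen_arcsin_strict_mono[of r 0 1] by simp

text \<open>Integration by parts of \<open>s \<mapsto> s * sqrt (1 - s powr r)\<close>.\<close>

lemma arcsin_area_relation:
  assumes "r \<ge> 1"
  shows "r * gen_arcsin r 1 = (r + 2) * area r 1"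
proof -
  let ?f = "\<lambda>s::real. sqrt (1 - s powr r)"
  \<comment> \<open>The product \<open>s * sqrt (1 - s powr r)\<close> vanishes at both ends. In its
    derivative, \<open>s powr r / sqrt (1 - s powr r)\<close> is rewritten as the difference of the
    integrands of \<open>gen_arcsin\<close> and \<open>area\<close>.\<close>
  have "((\<lambda>s. (1 + r / 2) * ?f s - r / 2 * (1 / ?f s)) has_integral (1 * ?f 1 - 0 * ?f 0)) {0..1}"
  proof (rule fundamental_theorem_of_calculus_interior)
    fix x :: real assume x: "x \<in> {0<..<1}"
    then have lt: "x powr r < 1" using powr_less_one_base[of x r] assms by auto
    have "((\<lambda>s. s * ?f s) has_real_derivative
        (?f x + x * (- (r * x powr (r - 1)) / (2 * ?f x)))) (at x)"
      using lt x by (auto intro!: derivative_eq_intros simp: field_simps)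
    moreover have "?f x + x * (- (r * x powr (r - 1)) / (2 * ?f x)) =
        (1 + r / 2) * ?f x - r / 2 * (1 / ?f x)"
    proof -
      have e: "x * x powr (r - 1) = x powr r" using x by (simp add: powr_mult_base)
      have "1 / ?f x - x powr r / ?f x = (1 - x powr r) / ?f x"
        by (simp add: diff_divide_distrib)
      also have "\<dots> = ?f x" by (simp add: real_div_sqrt lt less_imp_le)
      finally have f: "1 / ?f x - x powr r / ?f x = ?f x" .
      have "x * (- (r * x powr (r - 1)) / (2 * ?f x)) = - r / 2 * ((x * x powr (r - 1)) / ?f x)"
        by simp
      also have "\<dots> = r / 2 * (1 / ?f x - x powr r / ?f x) - r / 2 * (1 / ?f x)"
        unfolding e by (simp add: right_diff_distrib)
      also have "\<dots> = r / 2 * ?f x - r / 2 * (1 / ?f x)" unfolding f ..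
      finally show ?thesis by (simp add: distrib_right)
    qed
    ultimately show "((\<lambda>s. s * ?f s) has_vector_derivative
        (1 + r / 2) * ?f x - r / 2 * (1 / ?f x)) (at x)"
      by (simp add: has_real_derivative_iff_has_vector_derivative)
  next
    show "continuous_on {0..1} (\<lambda>s. s * ?f s)"
      using assms by (intro continuous_on_mult continuous_on_id continuous_on_sqrt_one_minus_powr) auto
  qed simp
  moreover have "((\<lambda>s. (1 + r / 2) * ?f s - r / 2 * (1 / ?f s)) has_integral
      ((1 + r / 2) * area r 1 - r / 2 * gen_arcsin r 1)) {0..1}"
    unfolding area_def gen_arcsin_def
    using arcsin_integrand_absolutely_integrable[OF assms] assms
    by (intro has_integral_diff has_integral_mult_right integrable_integral
        integrable_continuous_real set_lebesgue_integral_eq_integral(1) continuous_on_sqrt_one_minus_powr) auto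
  ultimately have "(1 + r / 2) * area r 1 - r / 2 * gen_arcsin r 1 = 1 * ?f 1 - 0 * ?f 0"
    by (rule has_integral_unique[rotated])
  then show ?thesis by (simp add: algebra_simps)
qed

lemma area_1_pos:
  assumes "r \<ge> 1"
  shows "0 < area r 1"
proof -
  have "area r 1 = r * gen_arcsin r 1 / (r + 2)"
    using arcsin_area_relation[OF assms] assms by (simp add: field_simps)
  then show ?thesis using gen_arcsin_1_pos[OF assms] assms by simp
qed

text \<open>Writing the numerator as \<open>1 - (1 - s powr r)\<close>, with
  \<open>r = p + 1\<close>, splits the integrand into those of \<open>A_const\<close> and
  \<open>B_const\<close>.\<close>

lemma C_const_eq:
  assumes "p > 1"
  shows "C_const p = gen_arcsin (p + 1) 1 - area (p + 1) 1"
proof -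
  let ?f = "\<lambda>s::real. sqrt (1 - s powr (p + 1))"
  have i1: "integrable (lebesgue_on {0<..<1}) (\<lambda>s. 1 / ?f s)"
    by (rule integrable_lebesgue_on_open_interval) (rule arcsin_integrand_absolutely_integrable, use assms in simp)
  have i2: "integrable (lebesgue_on {0<..<1}) ?f"
    by (rule integrable_lebesgue_on_open_interval_continuous) (rule continuous_on_sqrt_one_minus_powr, use assms in simp)
  have "C_const p = (LINT s|lebesgue_on {0<..<1}. 1 / ?f s - ?f s)"
    unfolding C_const_def
  proof (rule Bochner_Integration.integral_cong)
    fix s :: real assume "s \<in> space (lebesgue_on {0<..<1})"
    then have "s powr (p + 1) < 1" using powr_less_one_base[of s "p + 1"] assms by auto
    then have "(1 - s powr (p + 1)) / ?f s = ?f s" by (simp add: real_div_sqrt)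
    then show "s powr (p + 1) / ?f s = 1 / ?f s - ?f s" by (simp add: diff_divide_distrib)
  qed simp
  also have "\<dots> = A_const p - B_const p"
    unfolding A_const_def B_const_def by (rule Bochner_Integration.integral_diff[OF i1 i2])
  finally show ?thesis using assms by (simp add: A_const_eq_gen_arcsin B_const_eq_area)
qed

section \<open>The extremal profile\<close>

text \<open>Since \<open>gen_arcsin r\<close> maps \<open>{0..1}\<close> bijectively onto
  \<open>{0..gen_arcsin r 1}\<close>, the inverse is meaningful exactly for arguments with
  \<open>\<bar>x\<bar> \<le> 1\<close>. The absolute value builds in evenness, with the peak at
  0.\<close>

definition profile :: "real \<Rightarrow> real \<Rightarrow> real" where
  "profile r x = the_inv_into {0..1} (gen_arcsin r) (gen_arcsin r 1 * (1 - \<bar>x\<bar>))"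

lemma gen_arcsin_image:
  assumes "r \<ge> 1"
  shows "gen_arcsin r ` {0..1} = {0..gen_arcsin r 1}"
proof
  show "gen_arcsin r ` {0..1} \<subseteq> {0..gen_arcsin r 1}"
  proof clarify
    fix t :: real assume t: "t \<in> {0..1}"
    then have "t = 0 \<or> gen_arcsin r 0 < gen_arcsin r t" "t = 1 \<or> gen_arcsin r t < gen_arcsin r 1"
      using gen_arcsin_strict_mono[of r 0 t] gen_arcsin_strict_mono[of r t 1] assms
      by (cases "t = 0"; simp) (cases "t = 1"; use t gen_arcsin_strict_mono[of r t 1] assms in simp)
    then show "gen_arcsin r t \<in> {0..gen_arcsin r 1}" using gen_arcsin_1_pos[OF assms] by auto
  qed
  show "{0..gen_arcsin r 1} \<subseteq> gen_arcsin r ` {0..1}"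
  proof
    fix y assume "y \<in> {0..gen_arcsin r 1}"
    then have "\<exists>x\<ge>0. x \<le> 1 \<and> gen_arcsin r x = y"
      using IVT'[of "gen_arcsin r" 0 y 1] continuous_on_gen_arcsin[OF assms] by auto
    then show "y \<in> gen_arcsin r ` {0..1}" by auto
  qed
qed

lemma profile_arg: "\<bar>x\<bar> \<le> 1 \<Longrightarrow> r \<ge> 1 \<Longrightarrow> gen_arcsin r 1 * (1 - \<bar>x\<bar>) \<in> {0..gen_arcsin r 1}"
  using gen_arcsin_1_pos[of r] by (auto simp: mult_le_cancel_left1)

lemma
  assumes "r \<ge> 1" "\<bar>x\<bar> \<le> 1"
  shows gen_arcsin_profile: "gen_arcsin r (profile r x) = gen_arcsin r 1 * (1 - \<bar>x\<bar>)"
    and profile_in: "profile r x \<in> {0..1}"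
  unfolding profile_def
  using f_the_inv_into_f[OF gen_arcsin_inj[OF assms(1)]]
    the_inv_into_into[OF gen_arcsin_inj[OF assms(1)] _ order.refl]
    profile_arg[OF assms(2,1)] gen_arcsin_image[OF assms(1)] by blast+

lemma profile_eqI:
  assumes "r \<ge> 1" "\<bar>x\<bar> \<le> 1" "t \<in> {0..1}" "gen_arcsin r t = gen_arcsin r 1 * (1 - \<bar>x\<bar>)"
  shows "profile r x = t"
  using inj_onD[OF gen_arcsin_inj[OF assms(1)], of "profile r x" t] assms gen_arcsin_profile profile_in by simp

lemma profile_minus [simp]: "profile r (- x) = profile r x"
  by (simp add: profile_def)

lemma profile_boundary: "r \<ge> 1 \<Longrightarrow> \<bar>x\<bar> = 1 \<Longrightarrow> profile r x = 0"
  by (rule profile_eqI) auto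

lemma profile_0: "r \<ge> 1 \<Longrightarrow> profile r 0 = 1"
  by (rule profile_eqI) auto

lemma profile_strict:
  assumes "r \<ge> 1" "0 < \<bar>x\<bar>" "\<bar>x\<bar> < 1"
  shows "0 < profile r x" "profile r x < 1"
proof -
  have "gen_arcsin r (profile r x) = gen_arcsin r 1 * (1 - \<bar>x\<bar>)" using gen_arcsin_profile assms by simp
  moreover have "0 < gen_arcsin r 1 * (1 - \<bar>x\<bar>)" "gen_arcsin r 1 * (1 - \<bar>x\<bar>) < gen_arcsin r 1"
    using gen_arcsin_1_pos assms by auto
  ultimately have "profile r x \<noteq> 0" "profile r x \<noteq> 1" by auto
  then show "0 < profile r x" "profile r x < 1"
    using profile_in[OF assms(1), of x] assms by auto
qed

lemma continuous_on_profile: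
  assumes "r \<ge> 1"
  shows "continuous_on {-1..1} (profile r)"
proof -
  have "continuous_on (gen_arcsin r ` {0..1}) (the_inv_into {0..1} (gen_arcsin r))"
    by (rule continuous_on_inv[OF continuous_on_gen_arcsin[OF assms]])
      (auto simp: the_inv_into_f_f[OF gen_arcsin_inj[OF assms]])
  then have "continuous_on {0..gen_arcsin r 1} (the_inv_into {0..1} (gen_arcsin r))"
    by (simp add: gen_arcsin_image[OF assms])
  then have "continuous_on {-1..1} (the_inv_into {0..1} (gen_arcsin r) \<circ> (\<lambda>x. gen_arcsin r 1 * (1 - \<bar>x\<bar>)))"
    using profile_arg[OF _ assms]
    by (intro continuous_on_compose continuous_intros)
      (rule continuous_on_subset, assumption, auto)
  then show ?thesis by (simp add: profile_def o_def)
qed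

text \<open>The inverse function rule gives the left half, and evenness the right half. The origin
  is left out because the derivative of \<open>gen_arcsin r\<close> blows up at the peak value
  1.\<close>

lemma has_real_derivative_profile:
  assumes r: "r \<ge> 1" and x: "0 < \<bar>x\<bar>" "\<bar>x\<bar> < 1"
  shows "(profile r has_real_derivative - sgn x * gen_arcsin r 1 * sqrt (1 - profile r x powr r)) (at x)"
proof -
  have *: "(profile r has_real_derivative gen_arcsin r 1 * sqrt (1 - profile r y powr r)) (at y)"
    if y: "-1 < y" "y < 0" for y
  proof -
    let ?A = "gen_arcsin r 1" and ?t = "profile r y"
    have t: "0 < ?t" "?t < 1" using profile_strict[OF r, of y] y by auto
    have lt: "?t powr r < 1" using powr_less_one_base[of ?t r] t r by auto
    \<comment> \<open>On the left half \<open>1 - \<bar>y\<bar> = 1 + y\<close>, so this normalized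
      map is the one that \<open>profile r\<close> inverts there.\<close>
    have d: "((\<lambda>t. gen_arcsin r t / ?A - 1) has_real_derivative (1 / sqrt (1 - ?t powr r) / ?A)) (at ?t)"
      using t r gen_arcsin_1_pos[OF r] by (auto intro!: derivative_eq_intros has_real_derivative_gen_arcsin)
    have "(profile r has_real_derivative inverse (1 / sqrt (1 - ?t powr r) / ?A)) (at y)"
    proof (rule DERIV_inverse_function[where f = "\<lambda>t. gen_arcsin r t / ?A - 1" and g = "profile r" and x = y
          and a = "-1" and b = 0, OF d])
      show "1 / sqrt (1 - ?t powr r) / ?A \<noteq> 0"
        using lt gen_arcsin_1_pos[OF r] by (metis diff_gt_0_iff_gt divide_pos_pos less_irrefl real_sqrt_gt_zero zero_less_one)
      show "-1 < y" "y < 0" by fact+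
      show "gen_arcsin r (profile r z) / ?A - 1 = z" if "-1 < z" "z < 0" for z
        using that gen_arcsin_profile[OF r, of z] gen_arcsin_1_pos[OF r] by simp
      show "isCont (profile r) y"
        using continuous_on_profile[OF r] y by (simp add: continuous_on_interior)
    qed
    then show ?thesis by (simp add: mult.commute)
  qed
  show ?thesis
  proof (cases "x < 0")
    case True then show ?thesis using *[of x] x by simp
  next
    case False
    then have "x > 0" using x by auto
    have "((\<lambda>y. profile r (- y)) has_real_derivative
        (gen_arcsin r 1 * sqrt (1 - profile r (-x) powr r)) * (-1)) (at x)"
      by (rule DERIV_chain2[OF *]) (use x \<open>x > 0\<close> in \<open>auto intro!: derivative_eq_intros\<close>)
    then show ?thesis using \<open>x > 0\<close> by simp
  qed
qed

text \<open>An explicit formula for the derivative that also has values at 0 and at the endpoints.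
  It is continuous across 0, since the square root vanishes at the peak and cancels the jump of
  \<open>sgn\<close>.\<close>

definition profile_slope :: "real \<Rightarrow> real \<Rightarrow> real" where
  "profile_slope r x = - sgn x * gen_arcsin r 1 * sqrt (1 - profile r x powr r)"

lemma continuous_on_profile_slope:
  assumes "r \<ge> 1"
  shows "continuous_on {-1..1} (profile_slope r)"
proof -
  let ?h = "\<lambda>x. gen_arcsin r 1 * sqrt (1 - profile r x powr r)"
  have h: "continuous_on {-1..1} ?h"
    using profile_in[OF assms] assms
    by (intro continuous_on_mult continuous_on_const continuous_on_real_sqrt continuous_on_diff
        continuous_on_powr' continuous_on_profile) auto
  have "continuous_on ({-1..0} \<union> {0..1}) (\<lambda>x. if x \<le> 0 then ?h x else - ?h x)"
    by (rule continuous_on_If)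
      (auto simp: profile_0[OF assms] intro!: continuous_on_minus continuous_on_subset[OF h])
  also have "{-1..0} \<union> {0..1::real} = {-1..1}" by auto
  also have "(\<lambda>x. if x \<le> 0 then ?h x else - ?h x) = profile_slope r"
    by (auto simp: fun_eq_iff profile_slope_def sgn_if profile_0[OF assms])
  finally show ?thesis .
qed

lemma has_integral_profile_slope:
  assumes "r \<ge> 1" "-1 \<le> x" "x \<le> 1"
  shows "(profile_slope r has_integral profile r x) {-1..x}"
proof -
  have "(profile_slope r has_integral profile r x - profile r (-1)) {-1..x}"
  proof (rule fundamental_theorem_of_calculus_interior_strong[of "{0}"])
    show "continuous_on {-1..x} (profile r)"
      using continuous_on_profile[OF assms(1)] by (rule continuous_on_subset) (use assms in auto)
    show "(profile r has_vector_derivative profile_slope r y) (at y)" if "y \<in> {-1<..<x} - {0}" for y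
      using has_real_derivative_profile[of r y] that assms
      unfolding profile_slope_def has_real_derivative_iff_has_vector_derivative[symmetric] by auto
  qed (use assms in auto)
  then show ?thesis using profile_boundary[of r "-1"] assms by simp
qed

text \<open>On each side of 0, one factor of the square is
  \<open>- sgn x * A * sqrt (1 - w powr r)\<close>, where \<open>w\<close> is the profile and
  \<open>A = gen_arcsin r 1\<close>; the remaining product is the derivative of
  \<open>area r\<close> composed with \<open>w\<close>. Subtracting \<open>area r 1\<close> makes
  the two antiderivatives join continuously at 0.\<close>

lemma integral_profile_slope_square:
  assumes r: "r \<ge> 1"
  shows "integral {-1..1} (\<lambda>x. (profile_slope r x)\<^sup>2) = 2 * gen_arcsin r 1 * area r 1"
proof -
  let ?F = "\<lambda>x. - sgn x * (area r (profile r x) - area r 1)"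
  have F: "((\<lambda>x. (profile_slope r x)\<^sup>2) has_integral gen_arcsin r 1 * (?F 1 - ?F (-1))) {-1..1}"
  proof -
    have "((\<lambda>x. (profile_slope r x)\<^sup>2) has_integral (gen_arcsin r 1 * ?F 1 - gen_arcsin r 1 * ?F (-1))) {-1..1}"
    proof (rule fundamental_theorem_of_calculus_interior_strong[of "{0}"])
      have a: "continuous_on {-1..1} (\<lambda>x. area r (profile r x) - area r 1)"
        using r profile_in
        by (intro continuous_on_diff continuous_on_const
            continuous_on_compose2[OF continuous_on_area continuous_on_profile]) auto
      have "continuous_on ({-1..0} \<union> {0..1})
        (\<lambda>x. if x \<le> 0 then (area r (profile r x) - area r 1) else - (area r (profile r x) - area r 1))"
        by (rule continuous_on_If)
          (auto simp: profile_0[OF r] intro!: continuous_on_subset[OF a] continuous_on_minus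
              simp del: minus_diff_eq)
      also have "{-1..0} \<union> {0..1::real} = {-1..1}" by auto
      also have "(\<lambda>x. if x \<le> 0 then (area r (profile r x) - area r 1)
          else - (area r (profile r x) - area r 1)) = ?F"
        by (auto simp: fun_eq_iff sgn_if profile_0[OF r])
      finally show "continuous_on {-1..1} (\<lambda>x. gen_arcsin r 1 * ?F x)"
        by (rule continuous_on_mult[OF continuous_on_const])
    next
      fix x :: real assume "x \<in> {-1<..<1} - {0}"
      then have x: "0 < \<bar>x\<bar>" "\<bar>x\<bar> < 1" by auto
      let ?t = "profile r x"
      have t: "0 < ?t" "?t < 1" using profile_strict[OF r x] .
      have lt: "?t powr r < 1" using powr_less_one_base[of ?t r] t r by auto
      have "((\<lambda>y. area r (profile r y)) has_real_derivative sqrt (1 - ?t powr r) * profile_slope r x) (at x)"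
        unfolding profile_slope_def
        by (rule DERIV_chain2[OF area_has_real_derivative has_real_derivative_profile])
          (use r t x in auto)
      then have "((\<lambda>y. gen_arcsin r 1 * (- sgn x * (area r (profile r y) - area r 1))) has_real_derivative
         gen_arcsin r 1 * (- sgn x * (sqrt (1 - ?t powr r) * profile_slope r x))) (at x)"
        by (auto intro!: derivative_eq_intros)
      also have "gen_arcsin r 1 * (- sgn x * (sqrt (1 - ?t powr r) * profile_slope r x)) = (profile_slope r x)\<^sup>2"
        by (simp add: profile_slope_def power2_eq_square)
      finally have *: "((\<lambda>y. gen_arcsin r 1 * (- sgn x * (area r (profile r y) - area r 1))) has_real_derivative
         (profile_slope r x)\<^sup>2) (at x)" .
      \<comment> \<open>Away from 0 the sign is locally constant, so the antiderivative can be
        differentiated with its sign frozen.\<close>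
      have "\<forall>\<^sub>F y in nhds x. sgn y = sgn x"
      proof (cases "x > 0")
        case True
        then show ?thesis using eventually_nhds_in_open[of "{0<..}" x] by (auto elim!: eventually_mono)
      next
        case False
        then have "x < 0" using x by auto
        then show ?thesis using eventually_nhds_in_open[of "{..<0}" x] by (auto elim!: eventually_mono)
      qed
      then have ev: "\<forall>\<^sub>F y in nhds x. gen_arcsin r 1 * ?F y =
          gen_arcsin r 1 * (- sgn x * (area r (profile r y) - area r 1))"
        by (rule eventually_mono) simp
      with * have "((\<lambda>y. gen_arcsin r 1 * ?F y) has_real_derivative (profile_slope r x)\<^sup>2) (at x)"
        by (subst DERIV_cong_ev[OF refl ev refl])
      then show "((\<lambda>y. gen_arcsin r 1 * ?F y) has_vector_derivative (profile_slope r x)\<^sup>2) (at x)"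
        by (simp add: has_real_derivative_iff_has_vector_derivative)
    qed auto
    then show ?thesis by (simp only: right_diff_distrib)
  qed
  have "?F 1 - ?F (-1) = 2 * area r 1"
    using profile_boundary[OF r, of 1] by (simp add: area_def)
  then show ?thesis using integral_unique[OF F] by simp
qed

text \<open>The first-order equation expresses \<open>w powr r\<close> as
  \<open>1 - w'\<^sup>2 / A\<^sup>2\<close>, with \<open>w\<close> the profile and
  \<open>A = gen_arcsin r 1\<close>. This reduces the integral to that of the squared slope, and
  \<open>arcsin_area_relation\<close> removes the quotient of the two constants.\<close>

lemma integral_profile_powr:
  assumes r: "r \<ge> 1"
  shows "integral {-1..1} (\<lambda>x. profile r x powr r) = 4 / (r + 2)"
proof -
  let ?A = "gen_arcsin r 1"
  have A: "?A > 0" using gen_arcsin_1_pos[OF r] .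
  have eq: "profile r x powr r = 1 - (profile_slope r x)\<^sup>2 / ?A\<^sup>2" if "x \<in> {-1..1}" for x
  proof (cases "x = 0")
    case True then show ?thesis using r by (simp add: profile_0 profile_slope_def)
  next
    case False
    have "profile r x powr r \<le> 1" using profile_in[OF r, of x] that r by (auto intro!: powr_le1)
    then have "(profile_slope r x)\<^sup>2 = ?A\<^sup>2 * (1 - profile r x powr r)"
      using False by (simp add: profile_slope_def power_mult_distrib power2_eq_square[of "sgn x"] sgn_if)
    then show ?thesis using A by simp
  qed
  have "integral {-1..1} (\<lambda>x. profile r x powr r) = integral {-1..1} (\<lambda>x. 1 - (profile_slope r x)\<^sup>2 / ?A\<^sup>2)"
    by (rule integral_cong) (rule eq)
  also have "\<dots> = 2 - 2 * ?A * area r 1 / ?A\<^sup>2"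
  proof -
    have "((\<lambda>x. (profile_slope r x)\<^sup>2) has_integral 2 * ?A * area r 1) {-1..1}"
      unfolding integral_profile_slope_square[OF r, symmetric]
      using continuous_on_profile_slope[OF r]
      by (intro integrable_integral integrable_continuous_real continuous_intros)
    then have "((\<lambda>x. 1 - (profile_slope r x)\<^sup>2 / ?A\<^sup>2) has_integral (2 - 2 * ?A * area r 1 / ?A\<^sup>2)) {-1..1}"
      using has_integral_const_real[of "1::real" "-1" 1]
      by (intro has_integral_diff has_integral_divide) auto
    then show ?thesis by (rule integral_unique)
  qed
  also have "\<dots> = 2 - 2 * (area r 1 / ?A)" using A by (simp add: power2_eq_square)
  also have "area r 1 / ?A = r / (r + 2)" using arcsin_area_relation[OF r] A r by (simp add: field_simps)
  also have "2 - 2 * (r / (r + 2)) = 4 / (r + 2)" using r by (simp add: field_simps)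
  finally show ?thesis .
qed

section \<open>The sharp inequality for continuously differentiable functions\<close>

text \<open>The quotient of the Dirichlet integral to the power \<open>r / 2\<close> by the integral
  of the \<open>r\<close>-th power, evaluated at the profile: the two integrals are
  \<open>2 * gen_arcsin r 1 * area r 1\<close> and \<open>4 / (r + 2)\<close>.\<close>

definition best_const :: "real \<Rightarrow> real" where
  "best_const r = (2 * gen_arcsin r 1 * area r 1) powr (r / 2) * (r + 2) / 4"

lemma best_const_eq:
  assumes "p > 1"
  shows "best_const (p + 1) = 2 powr ((p - 3) / 2) * (p + 1) * A_const p powr ((p + 3) / 2)
                 * B_const p powr ((p - 1) / 2)"
proof -
  let ?A = "gen_arcsin (p + 1) 1" and ?B = "area (p + 1) 1"
  have A: "?A > 0" and B: "?B > 0" using gen_arcsin_1_pos area_1_pos assms by auto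
  \<comment> \<open>The relation between the two constants trades the factor
    \<open>r + 2 = p + 3\<close> for a quotient of them, which shifts their exponents to those of
    the theorem.\<close>
  have "p + 3 = (p + 1) * ?A / ?B"
    using arcsin_area_relation[of "p + 1"] assms B by (simp add: field_simps)
  then have "best_const (p + 1) = (2 * ?A * ?B) powr ((p + 1) / 2) * ((p + 1) * ?A / ?B) / 4"
    by (simp add: best_const_def add.assoc)
  also have "\<dots> = 2 powr ((p + 1) / 2 - 2) * (p + 1) * ?A powr ((p + 1) / 2 + 1) * ?B powr ((p + 1) / 2 - 1)"
    unfolding powr_diff powr_add using A B assms by (simp add: powr_mult field_simps)
  also have "(p + 1) / 2 - 2 = (p - 3) / 2" by (simp add: field_simps)
  also have "(p + 1) / 2 + 1 = (p + 3) / 2" by (simp add: field_simps)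
  also have "(p + 1) / 2 - 1 = (p - 1) / 2" by (simp add: field_simps)
  finally show ?thesis using assms by (simp add: A_const_eq_gen_arcsin B_const_eq_area)
qed

lemma best_const_pos: "r \<ge> 1 \<Longrightarrow> best_const r > 0"
  using gen_arcsin_1_pos[of r] area_1_pos[of r] by (simp add: best_const_def)

text \<open>By concavity the graph lies below its tangent at 1. This is Young's inequality for
  \<open>j\<close> and 1 with weights \<open>a\<close> and \<open>1 - a\<close>.\<close>

lemma powr_le_tangent:
  fixes j a :: real
  assumes "0 \<le> j" "0 < a" "a \<le> 1"
  shows "j powr a \<le> 1 + a * (j - 1)"
proof (cases "j = 0")
  case False
  then have j: "j > 0" using assms by simp
  have "j powr a * 1 powr (1 - a) \<le> a * j + (1 - a) * 1"
    by (rule Youngs_inequality_0) (use assms j in auto)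
  then show ?thesis by (simp add: algebra_simps)
qed (use assms in auto)

text \<open>Completing the square is lossless for the profile, where \<open>v' = A * g v\<close> to
  the left of the peak and \<open>v' = - A * g v\<close> to the right. The absolute value in
  \<open>g\<close> admits functions that change sign.\<close>

lemma dirichlet_lower_bound_normalized:
  assumes r: "r \<ge> 1"
    and der: "\<And>x. x \<in> {-1..1} \<Longrightarrow> (v has_real_derivative v' x) (at x within {-1..1})"
    and cont: "continuous_on {-1..1} v'"
    and bd: "v (-1) = 0" "v 1 = 0"
    and x0: "x0 \<in> {-1..1}" "v x0 = 1" and le: "\<And>x. x \<in> {-1..1} \<Longrightarrow> \<bar>v x\<bar> \<le> 1"
  shows "gen_arcsin r 1 * (4 * area r 1 - gen_arcsin r 1 * (2 - integral {-1..1} (\<lambda>x. \<bar>v x\<bar> powr r)))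
    \<le> integral {-1..1} (\<lambda>x. (v' x)\<^sup>2)"
proof -
  define A where "A = gen_arcsin r 1"
  define g where "g s = sqrt (1 - \<bar>s\<bar> powr r)" for s :: real
  \<comment> \<open>An antiderivative of \<open>g\<close>. Starting at -2 puts the whole range
    \<open>{-1..1}\<close> of \<open>v\<close> in the interior, so \<open>K\<close> has two-sided
    derivatives there.\<close>
  define K where "K t = integral {-2..t} g" for t
  have g: "continuous_on S g" for S
    unfolding g_def using r
    by (intro continuous_on_real_sqrt continuous_on_diff continuous_on_const continuous_on_powr'
        continuous_on_rabs continuous_on_id) auto
  have v: "continuous_on {-1..1} v"
    using der by (rule DERIV_continuous_on)
  have K: "(K has_real_derivative g t) (at t)" if "t \<in> {-1..1}" for t
  proof -
    have "(K has_real_derivative g t) (at t within {-2..2})"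
      unfolding K_def by (rule integral_has_real_derivative[OF g]) (use that in auto)
    then show ?thesis using that by (simp add: at_within_Icc_at)
  qed
  have K10: "K 1 - K 0 = area r 1"
  proof -
    have "integral {-2..0} g + integral {0..1} g = integral {-2..1} g"
      by (rule Henstock_Kurzweil_Integration.integral_combine) (auto intro!: integrable_continuous_real g)
    moreover have "integral {0..1} g = area r 1"
      unfolding area_def by (rule integral_cong) (simp add: g_def)
    ultimately show ?thesis by (simp add: K_def)
  qed
  have gv: "((\<lambda>x. g (v x) * v' x) has_integral K (v b) - K (v a)) {a..b}"
    if "a \<le> b" "{a..b} \<subseteq> {-1..1}" for a b
  proof (rule fundamental_theorem_of_calculus[where f = "\<lambda>x. K (v x)"])
    fix x assume x: "x \<in> {a..b}"
    have "((\<lambda>x. K (v x)) has_real_derivative g (v x) * v' x) (at x within {a..b})"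
    proof (rule DERIV_chain2[where f = K and g = v])
      show "(K has_real_derivative g (v x)) (at (v x))"
        using le[of x] x that by (intro K) auto
      show "(v has_real_derivative v' x) (at x within {a..b})"
        using der[of x] x that by (meson DERIV_subset subsetD)
    qed
    then show "((\<lambda>x. K (v x)) has_vector_derivative g (v x) * v' x) (at x within {a..b})"
      by (simp add: has_real_derivative_iff_has_vector_derivative)
  qed fact
  have cgv: "continuous_on {-1..1} (\<lambda>x. g (v x))"
    by (rule continuous_on_compose2[OF g v]) auto
  have i1: "(\<lambda>x. (v' x)\<^sup>2) integrable_on {a..b}" and i2: "(\<lambda>x. (g (v x))\<^sup>2) integrable_on {a..b}"
    if "{a..b} \<subseteq> {-1..1}" for a b
    using that by (auto intro!: integrable_continuous_real continuous_intros
        continuous_on_subset[OF cont] continuous_on_subset[OF cgv])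
  \<comment> \<open>The sign \<open>c\<close> is 1 to the left of the maximum and -1 to the right;
    only its square enters the expansion.\<close>
  have half: "2 * A * c * (K (v b) - K (v a)) \<le>
      integral {a..b} (\<lambda>x. (v' x)\<^sup>2) + A\<^sup>2 * integral {a..b} (\<lambda>x. (g (v x))\<^sup>2)"
    if ab: "a \<le> b" "{a..b} \<subseteq> {-1..1}" and c: "c\<^sup>2 = 1" for a b c :: real
  proof -
    have "((\<lambda>x. (v' x)\<^sup>2 - 2 * A * c * (g (v x) * v' x) + A\<^sup>2 * (g (v x))\<^sup>2) has_integral
        (integral {a..b} (\<lambda>x. (v' x)\<^sup>2) - 2 * A * c * (K (v b) - K (v a)) +
         A\<^sup>2 * integral {a..b} (\<lambda>x. (g (v x))\<^sup>2))) {a..b}"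
      by (intro has_integral_add has_integral_diff has_integral_mult_right integrable_integral
          i1 i2 gv ab)
    moreover have "0 \<le> (v' x)\<^sup>2 - 2 * A * c * (g (v x) * v' x) + A\<^sup>2 * (g (v x))\<^sup>2" for x
    proof -
      have "(v' x)\<^sup>2 - 2 * A * c * (g (v x) * v' x) + A\<^sup>2 * (g (v x))\<^sup>2 = (v' x - c * A * g (v x))\<^sup>2"
        using c by (simp add: power2_diff power_mult_distrib algebra_simps)
      then show ?thesis by simp
    qed
    ultimately have "0 \<le> integral {a..b} (\<lambda>x. (v' x)\<^sup>2) - 2 * A * c * (K (v b) - K (v a)) +
         A\<^sup>2 * integral {a..b} (\<lambda>x. (g (v x))\<^sup>2)"
      using has_integral_nonneg by blast
    then show ?thesis by simp
  qed
  have comb: "integral {-1..x0} f + integral {x0..1} f = integral {-1..1} f"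
    if "f integrable_on {-1..1}" for f :: "real \<Rightarrow> real"
    using x0 that by (intro Henstock_Kurzweil_Integration.integral_combine) auto
  have "integral {-1..1} (\<lambda>x. (g (v x))\<^sup>2) = integral {-1..1} (\<lambda>x. 1 - \<bar>v x\<bar> powr r)"
  proof (rule integral_cong)
    fix x :: real assume "x \<in> {-1..1}"
    then have "\<bar>v x\<bar> powr r \<le> 1" using le[of x] r by (auto intro!: powr_le1)
    then show "(g (v x))\<^sup>2 = 1 - \<bar>v x\<bar> powr r" by (simp add: g_def)
  qed
  also have "\<dots> = integral {-1..1} (\<lambda>x::real. 1) - integral {-1..1} (\<lambda>x. \<bar>v x\<bar> powr r)"
    using r v by (intro integral_diff integrable_continuous_real continuous_on_const
        continuous_on_powr' continuous_on_rabs) auto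
  finally have "integral {-1..1} (\<lambda>x. (g (v x))\<^sup>2) = 2 - integral {-1..1} (\<lambda>x. \<bar>v x\<bar> powr r)"
    by simp
  moreover have "2 * A * 1 * (K (v x0) - K (v (-1))) + 2 * A * (-1) * (K (v 1) - K (v x0)) \<le>
      integral {-1..1} (\<lambda>x. (v' x)\<^sup>2) + A\<^sup>2 * integral {-1..1} (\<lambda>x. (g (v x))\<^sup>2)"
    unfolding comb[OF i1[OF order.refl], symmetric] comb[OF i2[OF order.refl], symmetric] distrib_left
    using half[of "-1" x0 1] half[of x0 1 "-1"] x0(1) by simp
  \<comment> \<open>As \<open>v\<close> rises from 0 to 1 and returns to 0, each half contributes
    \<open>K 1 - K 0\<close>, which is \<open>area r 1\<close>.\<close>
  moreover have "2 * A * 1 * (K (v x0) - K (v (-1))) + 2 * A * (-1) * (K (v 1) - K (v x0)) = 4 * A * area r 1"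
    unfolding bd x0(2) K10[symmetric] by (simp add: algebra_simps)
  ultimately have "4 * A * area r 1 \<le> integral {-1..1} (\<lambda>x. (v' x)\<^sup>2) +
      A\<^sup>2 * (2 - integral {-1..1} (\<lambda>x. \<bar>v x\<bar> powr r))"
    by simp
  then show ?thesis
    unfolding A_def[symmetric] power2_eq_square[of A] by (simp add: algebra_simps)
qed

text \<open>Both sides are homogeneous of degree \<open>r\<close>, so dividing by the extremal value
  reduces to the normalized case. The affine bound obtained there is a tangent line, and concavity
  of the power \<open>2 / r\<close> (here \<open>r \<ge> 2\<close> enters) turns it into the power
  inequality.\<close>

lemma dirichlet_lower_bound:
  assumes r: "r \<ge> 2"
    and der: "\<And>x. x \<in> {-1..1} \<Longrightarrow> (v has_real_derivative v' x) (at x within {-1..1})"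
    and cont: "continuous_on {-1..1} v'"
    and bd: "v (-1) = 0" "v 1 = 0"
  shows "best_const r * integral {-1..1} (\<lambda>x. \<bar>v x\<bar> powr r)
    \<le> (integral {-1..1} (\<lambda>x. (v' x)\<^sup>2)) powr (r / 2)"
proof -
  define A where "A = gen_arcsin r 1"
  define B where "B = area r 1"
  have A: "A > 0" and B: "B > 0" using gen_arcsin_1_pos area_1_pos r by (auto simp: A_def B_def)
  have AB: "A * r = B * (r + 2)"
    using arcsin_area_relation[of r] r by (simp add: A_def B_def mult.commute)
  have v: "continuous_on {-1..1} v"
    using der by (rule DERIV_continuous_on)
  then obtain x0 where x0: "x0 \<in> {-1..1}" "\<And>x. x \<in> {-1..1} \<Longrightarrow> \<bar>v x\<bar> \<le> \<bar>v x0\<bar>"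
    using continuous_attains_sup[of "{-1..1}" "\<lambda>x. \<bar>v x\<bar>"] continuous_on_rabs[OF v] by fastforce
  show ?thesis
  proof (cases "v x0 = 0")
    case True
    then have "integral {-1..1} (\<lambda>x. \<bar>v x\<bar> powr r) = integral {-1..1} (\<lambda>x::real. 0)"
      using x0(2) by (intro integral_cong) auto
    then show ?thesis by simp
  next
    case False
    \<comment> \<open>Dividing by the signed value \<open>m\<close>, and not by its absolute value,
      makes the normalized function equal to 1 at \<open>x0\<close> even if \<open>v x0\<close> is
      negative.\<close>
    define m where "m = v x0"
    have m: "m \<noteq> 0" using False by (simp add: m_def)
    define w where "w x = v x / m" for x
    define J where "J = integral {-1..1} (\<lambda>x. \<bar>w x\<bar> powr r)"
    define D where "D = integral {-1..1} (\<lambda>x. (v' x / m)\<^sup>2)"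
    \<comment> \<open>Measures \<open>J\<close> in units of its value \<open>4 / (r + 2)\<close> at
      the profile, so that the extremal case is the point of tangency \<open>j = 1\<close>.\<close>
    define j where "j = J * (r + 2) / 4"
    have J0: "J \<ge> 0" unfolding J_def w_def using v m r
      by (intro Henstock_Kurzweil_Integration.integral_nonneg integrable_continuous_real
          continuous_on_powr' continuous_on_rabs continuous_intros) auto
    have D0: "D \<ge> 0" unfolding D_def using cont m
      by (intro Henstock_Kurzweil_Integration.integral_nonneg integrable_continuous_real continuous_intros) auto
    have "A * (4 * B - A * (2 - J)) \<le> D"
      unfolding A_def B_def J_def D_def
    proof (rule dirichlet_lower_bound_normalized[of _ _ _ x0])
      show "(w has_real_derivative v' x / m) (at x within {-1..1})" if "x \<in> {-1..1}" for x
        unfolding w_def using der[OF that] by (rule DERIV_cdivide)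
      show "\<bar>w x\<bar> \<le> 1" if "x \<in> {-1..1}" for x
        using x0(2)[OF that] m by (simp add: w_def m_def)
    qed (use r x0 m bd cont in \<open>auto simp: w_def m_def intro!: continuous_intros\<close>)
    also have "A * (4 * B - A * (2 - J)) = 2 * A * B * (1 + 2 / r * (j - 1))"
    proof -
      have B': "B = A * r / (r + 2)" using AB r by (simp add: field_simps)
      have "4 * r / (r + 2) - (2 - J) = 2 * (r / (r + 2) * (1 + 2 / r * (j - 1)))"
      proof -
        have "r / (r + 2) * (1 + 2 / r * (j - 1)) = (r - 2 + 2 * j) / (r + 2)"
        proof -
          have "1 + 2 / r * (j - 1) = (r - 2 + 2 * j) / r"
            using r by (simp add: field_simps)
          then show ?thesis using r by simp
        qed
        also have "\<dots> = (r - 2) / (r + 2) + J / 2"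
        proof -
          have "2 * j = (r + 2) * (J / 2)" by (simp add: j_def)
          then show ?thesis using r by (simp add: add_divide_distrib)
        qed
        finally show ?thesis using r by (simp add: field_simps)
      qed
      moreover have "A * (4 * B - A * (2 - J)) = A * A * (4 * r / (r + 2) - (2 - J))"
        unfolding B' by (simp add: right_diff_distrib)
      ultimately show ?thesis unfolding B' by simp
    qed
    finally have le: "2 * A * B * (1 + 2 / r * (j - 1)) \<le> D" .
    have j0: "j \<ge> 0" using J0 r by (simp add: j_def)
    have "j powr (2 / r) \<le> 1 + 2 / r * (j - 1)"
      by (rule powr_le_tangent) (use r j0 in auto)
    then have "2 * A * B * j powr (2 / r) \<le> D"
      using le A B by (smt (verit) mult_left_mono mult_pos_pos)
    then have "(2 * A * B * j powr (2 / r)) powr (r / 2) \<le> D powr (r / 2)"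
      using A B r j0 by (intro powr_mono2) auto
    also have "(2 * A * B * j powr (2 / r)) powr (r / 2) = (2 * A * B) powr (r / 2) * j"
      using A B r j0 by (simp add: powr_mult powr_powr)
    also have "\<dots> = best_const r * J" by (simp add: best_const_def A_def B_def j_def)
    finally have *: "best_const r * J \<le> D powr (r / 2)" .
    have "J = integral {-1..1} (\<lambda>x. \<bar>v x\<bar> powr r) / \<bar>m\<bar> powr r"
      unfolding J_def w_def by (simp add: powr_divide)
    moreover have "D powr (r / 2) = (integral {-1..1} (\<lambda>x. (v' x)\<^sup>2)) powr (r / 2) / \<bar>m\<bar> powr r"
    proof -
      have "D = integral {-1..1} (\<lambda>x. (v' x)\<^sup>2) / m\<^sup>2"
        unfolding D_def by (simp add: power_divide)
      moreover have "m\<^sup>2 powr (r / 2) = \<bar>m\<bar> powr r"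
      proof -
        have "m\<^sup>2 = \<bar>m\<bar> powr 2" using m by simp
        then show ?thesis by (simp only: powr_powr) simp
      qed
      ultimately show ?thesis using D0 using m by (simp add: powr_divide zero_le_divide_iff)
    qed
    ultimately show ?thesis using * m by (simp add: divide_le_cancel)
  qed
qed

section \<open>Smooth cutoffs and approximation by test functions\<close>

text \<open>The classical smooth function \<open>exp (- 1 / t)\<close> together with its quotients
  by powers of \<open>t\<close>. Derivatives are linear combinations of members of the family, so
  one derivative formula yields smoothness.\<close>

definition flat :: "nat \<Rightarrow> real \<Rightarrow> real" where
  "flat k t = (if t > 0 then exp (- 1 / t) / t ^ k else 0)"

text \<open>In the variable \<open>1 / t\<close> this is the decay of a power divided by an
  exponential.\<close>

lemma flat_tendsto_0: "(flat k \<longlongrightarrow> 0) (at 0)"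
proof -
  have "((\<lambda>t. inverse t ^ k / exp (inverse t)) \<longlongrightarrow> (0::real)) (at_right 0)"
    by (rule filterlim_compose[OF tendsto_power_div_exp_0 filterlim_inverse_at_top_right])
  then have "(flat k \<longlongrightarrow> 0) (at_right 0)"
    by (rule Lim_transform_eventually)
      (auto simp: eventually_at_right_field flat_def exp_minus field_simps intro!: exI[of _ 1])
  moreover have "(flat k \<longlongrightarrow> 0) (at_left 0)"
    by (rule Lim_transform_eventually[OF tendsto_const])
      (auto simp: eventually_at_left_field flat_def intro!: exI[of _ "-1"])
  ultimately show ?thesis by (simp add: filterlim_split_at)
qed

lemma has_real_derivative_flat:
  "(flat k has_real_derivative flat (k + 2) t - k * flat (k + 1) t) (at t)"
proof -
  consider "t > 0" | "t < 0" | "t = 0" by linarith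
  then show ?thesis
  proof cases
    case 1
    have "((\<lambda>t. exp (- 1 / t) / t ^ k) has_real_derivative flat (k + 2) t - k * flat (k + 1) t) (at t)"
    proof (cases k)
      case 0
      then show ?thesis using 1
        by (auto intro!: derivative_eq_intros simp: flat_def power2_eq_square divide_simps)
    next
      case (Suc m)
      then show ?thesis using 1
        by (auto intro!: derivative_eq_intros simp: flat_def divide_simps)
          (cases m; simp add: algebra_simps)
    qed
    then show ?thesis
      by (rule has_field_derivative_transform_within_open[of _ _ _ "{0<..}"])
        (use 1 in \<open>auto simp: flat_def\<close>)
  next
    case 2
    have "((\<lambda>t. 0) has_real_derivative flat (k + 2) t - k * flat (k + 1) t) (at t)"
      using 2 by (simp add: flat_def)
    then show ?thesis
      by (rule has_field_derivative_transform_within_open[of _ _ _ "{..<0}"])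
        (use 2 in \<open>auto simp: flat_def\<close>)
  next
    case 3
    \<comment> \<open>At the origin, forming the difference quotient just raises the index by one,
      so the derivative there is a limit already known.\<close>
    have "(\<lambda>h. (flat k (0 + h) - flat k 0) / h) = flat (k + 1)"
      by (simp add: flat_def fun_eq_iff)
    then have "(flat k has_real_derivative 0) (at 0)"
      using flat_tendsto_0[of "k + 1"] by (simp only: DERIV_def)
    then show ?thesis using 3 by (simp add: flat_def)
  qed
qed

text \<open>A class closed under differentiation: the polynomial coefficients absorb the chain rule
  factor \<open>- 2 * c * x\<close>, and sums absorb the product rule. For positive \<open>a\<close>
  and \<open>c\<close> its members vanish where \<open>\<bar>x\<bar> \<ge> a\<close>; a large
  \<open>c\<close> makes the transition steep.\<close>

inductive_set bumps :: "real \<Rightarrow> real \<Rightarrow> (real \<Rightarrow> real) set" for a c where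
  base: "real_polynomial_function P \<Longrightarrow> (\<lambda>x. P x * flat k (c * (a\<^sup>2 - x\<^sup>2))) \<in> bumps a c"
| add: "f \<in> bumps a c \<Longrightarrow> g \<in> bumps a c \<Longrightarrow> (\<lambda>x. f x + g x) \<in> bumps a c"

lemma bumps_derivative:
  "f \<in> bumps a c \<Longrightarrow> \<exists>f'\<in>bumps a c. \<forall>x. (f has_real_derivative f' x) (at x)"
proof (induction rule: bumps.induct)
  case (base P k)
  obtain P' where P': "real_polynomial_function P'" "\<And>x. (P has_real_derivative P' x) (at x)"
    using has_real_derivative_polynomial_function[OF base] by blast
  have Q: "real_polynomial_function (\<lambda>x. P x * (- 2 * c * x))"
    by (intro real_polynomial_function.intros(4) base real_polynomial_function.intros(2)
        real_polynomial_function.intros(1) bounded_linear_ident)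
  have Q2: "real_polynomial_function (\<lambda>x. P x * (- 2 * c * x) * (- real k))"
    by (intro real_polynomial_function.intros(4) Q real_polynomial_function.intros(2))
  let ?t = "\<lambda>x. c * (a\<^sup>2 - x\<^sup>2)"
  let ?f' = "\<lambda>x. P' x * flat k (?t x) + (P x * (- 2 * c * x) * flat (k + 2) (?t x) +
     P x * (- 2 * c * x) * (- real k) * flat (k + 1) (?t x))"
  have "?f' \<in> bumps a c"
    by (intro bumps.intros P' Q Q2)
  moreover have "((\<lambda>x. P x * flat k (?t x)) has_real_derivative ?f' x) (at x)" for x
  proof -
    have "((\<lambda>x. flat k (?t x)) has_real_derivative
        (flat (k + 2) (?t x) - k * flat (k + 1) (?t x)) * (c * (- 2 * x))) (at x)"
      by (rule DERIV_chain2[OF has_real_derivative_flat]) (auto intro!: derivative_eq_intros)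
    then show ?thesis
      using P'(2)[of x] by (auto intro!: derivative_eq_intros simp: algebra_simps)
  qed
  ultimately show ?case by (intro bexI[of _ ?f'] allI)
next
  case (add f g)
  then obtain f' g' where "f' \<in> bumps a c" "g' \<in> bumps a c"
    "\<And>x. (f has_real_derivative f' x) (at x)" "\<And>x. (g has_real_derivative g' x) (at x)" by blast
  then show ?case
    by (intro bexI[of _ "\<lambda>x. f' x + g' x"]) (auto intro: bumps.add DERIV_add)
qed

lemma higher_deriv_bumps: "f \<in> bumps a c \<Longrightarrow> (deriv ^^ n) f \<in> bumps a c"
proof (induction n)
  case (Suc n)
  then obtain f' where f': "f' \<in> bumps a c" "\<And>x. ((deriv ^^ n) f has_real_derivative f' x) (at x)"
    using bumps_derivative by blast
  then have "deriv ((deriv ^^ n) f) = f'" by (auto simp: fun_eq_iff DERIV_imp_deriv)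
  then show ?case using f' by simp
qed simp

lemma bumps_differentiable: "f \<in> bumps a c \<Longrightarrow> f differentiable (at x)"
  using bumps_derivative real_differentiable_def by blast

lemma bumps_eq_0:
  "f \<in> bumps a c \<Longrightarrow> c > 0 \<Longrightarrow> a > 0 \<Longrightarrow> a \<le> \<bar>x\<bar> \<Longrightarrow> f x = 0"
proof (induction rule: bumps.induct)
  case (base P k)
  then have "a\<^sup>2 \<le> x\<^sup>2" by (simp add: abs_le_square_iff[symmetric])
  then have "c * (a\<^sup>2 - x\<^sup>2) \<le> 0" using base by (simp add: mult_le_0_iff)
  then show ?case by (simp add: flat_def)
qed simp

text \<open>The zero mean makes the antiderivative vanish to the right of \<open>a\<close> as well,
  which gives compact support. Its higher derivatives are those of \<open>f\<close>.\<close>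

lemma bumps_antiderivative:
  assumes f: "f \<in> bumps a c" and c: "c > 0" and a: "0 < a" "a < 1"
    and int: "integral {-1..1} f = 0"
  defines "\<psi> \<equiv> \<lambda>x. integral {-1..x} f"
  shows "\<psi> \<in> test_functions_I" "deriv \<psi> = f"
proof -
  have cont: "continuous_on S f" for S
    using bumps_differentiable[OF f]
    by (meson continuous_at_imp_continuous_on differentiable_imp_continuous_within)
  have int0: "integral {u..v} f = 0" if "v \<le> -a \<or> a \<le> u" for u v
  proof -
    have "integral {u..v} f = integral {u..v} (\<lambda>x. 0)"
      using that bumps_eq_0[OF f c a(1)] by (intro integral_cong) auto
    then show ?thesis by simp
  qed
  have der: "(\<psi> has_real_derivative f x) (at x)" for x
  proof (cases "x > -1")
    case True
    have "(\<psi> has_real_derivative f x) (at x within {-1..x+1})"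
      unfolding \<psi>_def by (rule integral_has_real_derivative[OF cont]) (use True in auto)
    then show ?thesis using True by (simp add: at_within_Icc_at)
  next
    case False
    \<comment> \<open>Left of \<open>-a\<close> the function is constantly 0: \<open>f\<close>
      vanishes there, and for \<open>x < -1\<close> the interval of integration is empty.\<close>
    have "((\<lambda>x. 0) has_real_derivative f x) (at x)"
      using False bumps_eq_0[OF f c a(1), of x] a by simp
    then show ?thesis
      by (rule has_field_derivative_transform_within_open[of _ _ _ "{..<-a}"])
        (use False a int0 in \<open>auto simp: \<psi>_def\<close>)
  qed
  then show deriv: "deriv \<psi> = f" by (auto simp: fun_eq_iff DERIV_imp_deriv)
  have zero: "\<psi> x = 0" if "x \<notin> {-a..a}" for x
  proof (cases "x < -a")
    case False
    then have x: "x > a" using that by auto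
    have "integral {-1..a} f + integral {a..1} f = integral {-1..1} f"
      using a by (intro Henstock_Kurzweil_Integration.integral_combine integrable_continuous_real cont) auto
    moreover have "integral {-1..a} f + integral {a..x} f = integral {-1..x} f"
      using a x by (intro Henstock_Kurzweil_Integration.integral_combine integrable_continuous_real cont) auto
    ultimately show ?thesis using int int0 by (simp add: \<psi>_def)
  qed (use int0 in \<open>simp add: \<psi>_def\<close>)
  have "(deriv ^^ n) \<psi> differentiable (at x)" for n x
  proof (cases n)
    case 0
    then show ?thesis using der real_differentiable_def by auto
  next
    case (Suc m)
    then have "(deriv ^^ n) \<psi> = (deriv ^^ m) f"
      by (simp only: funpow_Suc_right o_def deriv)
    then show ?thesis using bumps_differentiable[OF higher_deriv_bumps[OF f]] by simp
  qed
  moreover have "compact {-a..a}" "{-a..a} \<subseteq> interval_I" using a by auto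
  ultimately show "\<psi> \<in> test_functions_I"
    unfolding test_functions_I_def using zero by blast
qed

text \<open>The radius \<open>1 - 1 / (n + 2)\<close> is at least one half and stays below 1, while
  the factor \<open>Suc n\<close> drives the argument of \<open>flat 0\<close> to infinity at each
  interior point. Hence the cutoffs tend to 1 pointwise on the open interval.\<close>

definition cutoff :: "nat \<Rightarrow> real \<Rightarrow> real" where
  "cutoff n x = flat 0 (real (Suc n) * ((1 - 1 / real (n + 2))\<^sup>2 - x\<^sup>2))"

lemma cutoff_bounds: "0 \<le> cutoff n x" "cutoff n x \<le> 1"
  by (auto simp: cutoff_def flat_def)

lemma cutoff_bumps:
  "real_polynomial_function P \<Longrightarrow>
    (\<lambda>x. P x * cutoff n x) \<in> bumps (1 - 1 / real (n + 2)) (real (Suc n))"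
  unfolding cutoff_def by (rule bumps.base)

lemma cutoff_tendsto_1:
  assumes "\<bar>x\<bar> < 1"
  shows "(\<lambda>n. cutoff n x) \<longlonglongrightarrow> 1"
proof -
  have x2: "x\<^sup>2 < 1" using assms by (simp add: abs_square_less_1)
  have "(\<lambda>n. 1 / real (n + 2)) \<longlonglongrightarrow> 0"
    using LIMSEQ_ignore_initial_segment[OF lim_1_over_n, of 2] by simp
  then have "(\<lambda>n. (1 - 1 / real (n + 2))\<^sup>2 - x\<^sup>2) \<longlonglongrightarrow> (1 - 0)\<^sup>2 - x\<^sup>2"
    by (intro tendsto_intros)
  moreover have "filterlim (\<lambda>n. real (Suc n)) at_top sequentially"
    using filterlim_real_sequentially by (simp only: filterlim_sequentially_Suc)
  ultimately have lim: "filterlim (\<lambda>n. real (Suc n) * ((1 - 1 / real (n + 2))\<^sup>2 - x\<^sup>2)) at_top sequentially"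
    by (subst mult.commute, intro filterlim_tendsto_pos_mult_at_top) (use x2 in auto)
  have "((\<lambda>t. exp (- inverse t)) \<longlongrightarrow> exp (- 0)) (at_top :: real filter)"
    by (intro tendsto_intros tendsto_inverse_0_at_top filterlim_ident)
  then have "(flat 0 \<longlongrightarrow> 1) at_top"
    by (auto elim!: Lim_transform_eventually intro!: eventually_mono[OF eventually_gt_at_top[of 0]]
        simp: flat_def divide_inverse)
  from filterlim_compose[OF this lim] show ?thesis by (simp add: cutoff_def)
qed

text \<open>The derivative is what gets approximated: Weierstrass polynomials times cutoffs,
  corrected to mean zero and then integrated. Uniform boundedness with pointwise convergence is the
  form that dominated convergence requires later.\<close>

lemma test_functions_approximation:
  assumes f: "continuous_on {-1..1} f" and int: "integral {-1..1} f = 0"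
  obtains \<psi> :: "nat \<Rightarrow> real \<Rightarrow> real" and M where
    "\<And>n. \<psi> n \<in> test_functions_I"
    "\<And>n x. x \<in> {-1..1} \<Longrightarrow> \<bar>deriv (\<psi> n) x\<bar> \<le> M"
    "\<And>x. x \<in> interval_I \<Longrightarrow> (\<lambda>n. deriv (\<psi> n) x) \<longlonglongrightarrow> f x"
    "\<And>n. continuous_on {-1..1} (deriv (\<psi> n))"
    "\<And>n x. \<psi> n x = integral {-1..x} (deriv (\<psi> n))"
proof -
  have "\<exists>P. real_polynomial_function P \<and> (\<forall>x\<in>{-1..1}. \<bar>f x - P x\<bar> < 1 / real (Suc n))" for n
    using Stone_Weierstrass_real_polynomial_function[OF compact_Icc f, of "1 / real (Suc n)"]
    by (metis divide_pos_pos of_nat_0_less_iff zero_less_Suc zero_less_one)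
  then obtain P where P: "\<And>n. real_polynomial_function (P n)"
    "\<And>n x. x \<in> {-1..1} \<Longrightarrow> \<bar>f x - P n x\<bar> < 1 / real (Suc n)" by metis
  obtain K where K: "\<And>x. x \<in> {-1..1} \<Longrightarrow> \<bar>f x\<bar> \<le> K"
    using compact_imp_bounded[OF compact_continuous_image[OF f compact_Icc]]
    unfolding bounded_iff by fastforce
  have Pb: "\<bar>P n x\<bar> \<le> K + 1" if "x \<in> {-1..1}" for n x
  proof -
    have "1 / real (Suc n) \<le> 1" by simp
    then show ?thesis using P(2)[OF that, of n] K[OF that] by linarith
  qed
  have Plim: "(\<lambda>n. P n x) \<longlonglongrightarrow> f x" if "x \<in> {-1..1}" for x
  proof -
    have "(\<lambda>n. f x - P n x) \<longlonglongrightarrow> 0"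
      by (rule Lim_null_comparison[OF _ LIMSEQ_inverse_real_of_nat])
        (use P(2)[OF that] in \<open>auto simp: inverse_eq_divide less_imp_le\<close>)
    from tendsto_diff[OF tendsto_const[of "f x"] this] show ?thesis by simp
  qed
  have bump: "(\<lambda>x. Q x * cutoff n x) \<in> bumps (1 - 1 / real (n + 2)) (real (Suc n))"
    if "real_polynomial_function Q" for Q n using that by (rule cutoff_bumps)
  have cont: "continuous_on S (\<lambda>x. Q x * cutoff n x)" if "real_polynomial_function Q" for Q n S
    using bumps_differentiable[OF bump[OF that]]
    by (meson continuous_at_imp_continuous_on differentiable_imp_continuous_within)
  have dc: "(\<lambda>n. integral {-1..1} (\<lambda>x. Q n x * cutoff n x)) \<longlonglongrightarrow> integral {-1..1} g"
    if Q: "\<And>n. real_polynomial_function (Q n)"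
      and b: "\<And>n x. x \<in> {-1..1} \<Longrightarrow> \<bar>Q n x\<bar> \<le> L"
      and l: "\<And>x. x \<in> {-1..1} \<Longrightarrow> (\<lambda>n. Q n x) \<longlonglongrightarrow> g x" for Q g L
  proof -
    have "(\<lambda>n. integral {-1<..<1} (\<lambda>x. Q n x * cutoff n x)) \<longlonglongrightarrow> integral {-1<..<1} g"
    proof (rule dominated_convergence(2)[where h = "\<lambda>_. L"])
      show "(\<lambda>x. Q n x * cutoff n x) integrable_on {-1<..<1}" for n
        using integrable_continuous_real[OF cont[OF Q]] by (simp add: integrable_on_open_interval_real)
      show "norm (Q n x * cutoff n x) \<le> L" if "x \<in> {-1<..<1}" for n x
      proof -
        have "\<bar>Q n x\<bar> * cutoff n x \<le> \<bar>Q n x\<bar> * 1"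
          by (rule mult_left_mono[OF cutoff_bounds(2)]) simp
        then show ?thesis using b[of x n] that cutoff_bounds(1)[of n x] by (simp add: abs_mult)
      qed
      show "(\<lambda>n. Q n x * cutoff n x) \<longlonglongrightarrow> g x" if "x \<in> {-1<..<1}" for x
        using tendsto_mult[OF l cutoff_tendsto_1, of x] that by auto
    qed (simp add: integrable_on_open_interval_real integrable_const_ivl)
    then show ?thesis by (simp add: integral_open_interval_real)
  qed
  define I where "I n = integral {-1..1} (cutoff n)" for n
  \<comment> \<open>This multiple of the cutoff restores the zero mean. It tends to 0, since the
    numerator tends to the integral of \<open>f\<close>, which is 0, and \<open>I\<close> tends to
    2.\<close>
  define c where "c n = integral {-1..1} (\<lambda>x. P n x * cutoff n x) / I n" for n
  define g where "g n x = (P n x - c n) * cutoff n x" for n x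
  define \<psi> where "\<psi> n x = integral {-1..x} (g n)" for n x
  have "I \<longlonglongrightarrow> integral {-1..1} (\<lambda>x::real. 1::real)"
    using dc[of "\<lambda>_ _. 1" 1 "\<lambda>_. 1"] unfolding I_def by (auto simp: real_polynomial_function.intros(2))
  then have I2: "I \<longlonglongrightarrow> 2" by simp
  have "(\<lambda>n. integral {-1..1} (\<lambda>x. P n x * cutoff n x)) \<longlonglongrightarrow> integral {-1..1} f"
    by (rule dc[OF P(1) Pb Plim])
  then have c0: "c \<longlonglongrightarrow> 0"
    using tendsto_divide[OF _ I2] int unfolding c_def[abs_def] by fastforce
  obtain C where C: "\<And>n. \<bar>c n\<bar> \<le> C"
    using convergent_imp_Bseq[of c] c0 by (auto simp: Bseq_def convergent_def)
  \<comment> \<open>From \<open>N\<close> on the division by \<open>I n\<close> is legitimate; the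
    final sequence is shifted by \<open>N\<close>.\<close>
  obtain N where N: "\<And>n. n \<ge> N \<Longrightarrow> I n > 1"
    using order_tendstoD(1)[OF I2, of 1] by (auto simp: eventually_sequentially)
  have poly: "real_polynomial_function (\<lambda>x. P n x - c n)" for n
    using P(1) by (intro real_polynomial_function_diff real_polynomial_function.intros(2))
  have gb: "g n \<in> bumps (1 - 1 / real (n + 2)) (real (Suc n))" for n
    unfolding g_def[abs_def] by (rule bump[OF poly])
  have g0: "integral {-1..1} (g n) = 0" if "n \<ge> N" for n
  proof -
    have "integral {-1..1} (g n) =
        integral {-1..1} (\<lambda>x. P n x * cutoff n x - c n * cutoff n x)"
      by (simp add: g_def[abs_def] left_diff_distrib)
    also have "\<dots> = integral {-1..1} (\<lambda>x. P n x * cutoff n x) - integral {-1..1} (\<lambda>x. c n * cutoff n x)"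
      using cont[OF P(1)] cont[OF real_polynomial_function.intros(2)]
      by (intro integral_diff integrable_continuous_real)
    also have "\<dots> = 0" using N[OF that] by (simp add: c_def I_def)
    finally show ?thesis .
  qed
  have a: "0 < 1 - 1 / real (n + 2)" "1 - 1 / real (n + 2) < 1" for n by (auto simp: field_simps)
  have test: "\<psi> n \<in> test_functions_I" "deriv (\<psi> n) = g n" if "n \<ge> N" for n
    unfolding \<psi>_def[abs_def]
    using bumps_antiderivative[OF gb _ a g0[OF that]] by simp_all
  show thesis
  proof (rule that[of "\<lambda>n. \<psi> (n + N)" "K + 1 + C"])
    show "\<psi> (n + N) \<in> test_functions_I" for n by (rule test) simp
    have d: "deriv (\<psi> (n + N)) = g (n + N)" for n by (rule test) simp
    show "\<bar>deriv (\<psi> (n + N)) x\<bar> \<le> K + 1 + C" if "x \<in> {-1..1}" for n x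
    proof -
      let ?n = "n + N"
      have "\<bar>P ?n x - c ?n\<bar> * cutoff ?n x \<le> \<bar>P ?n x - c ?n\<bar> * 1"
        by (rule mult_left_mono[OF cutoff_bounds(2)]) simp
      then show ?thesis
        using Pb[OF that, of ?n] C[of ?n] cutoff_bounds(1)[of ?n x]
        by (simp add: d g_def abs_mult)
    qed
    show "(\<lambda>n. deriv (\<psi> (n + N)) x) \<longlonglongrightarrow> f x" if "x \<in> interval_I" for x
    proof -
      have "(\<lambda>n. g n x) \<longlonglongrightarrow> (f x - 0) * 1"
        unfolding g_def using that by (intro tendsto_intros Plim c0 cutoff_tendsto_1) auto
      from LIMSEQ_ignore_initial_segment[OF this, of N] show ?thesis unfolding d by simp
    qed
    show "continuous_on {-1..1} (deriv (\<psi> (n + N)))" for n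
      unfolding d g_def[abs_def] by (rule cont[OF poly])
    show "\<psi> (n + N) x = integral {-1..x} (deriv (\<psi> (n + N)))" for n x
      unfolding d \<psi>_def ..
  qed
qed

section \<open>Test functions as competitors\<close>

abbreviation meas_I :: "real measure" where
  "meas_I \<equiv> lebesgue_on interval_I"

lemma integral_profile_slope: "r \<ge> 1 \<Longrightarrow> integral {-1..1} (profile_slope r) = 0"
  using has_integral_profile_slope[of r 1] profile_boundary[of r 1] by (simp add: integral_unique)

lemma L2_norm_I_square: "(L2_norm_I f)\<^sup>2 = (LINT x|meas_I. (f x)\<^sup>2)"
  by (simp add: L2_norm_I_def Bochner_Integration.integral_nonneg)

lemma L2_norm_I_powr:
  "L2_norm_I f powr r = (LINT x|meas_I. (f x)\<^sup>2) powr (r / 2)"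
  unfolding L2_norm_I_def
  by (simp add: powr_half_sqrt[symmetric] powr_powr Bochner_Integration.integral_nonneg)

lemma L2_I_mult:
  assumes "f \<in> L2_I" "g \<in> L2_I"
  shows "integrable meas_I (\<lambda>x. f x * g x)"
proof (rule Bochner_Integration.integrable_bound)
  show "integrable meas_I (\<lambda>x. (f x)\<^sup>2 + (g x)\<^sup>2)"
    using assms by (auto simp: L2_I_def)
  show "(\<lambda>x. f x * g x) \<in> borel_measurable meas_I"
    using assms by (auto simp: L2_I_def)
  have "norm (f x * g x) \<le> norm ((f x)\<^sup>2 + (g x)\<^sup>2)" for x
  proof -
    have "2 * (\<bar>f x\<bar> * \<bar>g x\<bar>) \<le> (f x)\<^sup>2 + (g x)\<^sup>2"
      using zero_le_power2[of "\<bar>f x\<bar> - \<bar>g x\<bar>"] by (simp add: power2_diff)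
    moreover have "0 \<le> \<bar>f x\<bar> * \<bar>g x\<bar>" by simp
    ultimately show ?thesis by (simp only: real_norm_def abs_mult abs_of_nonneg sum_power2_ge_zero)
  qed
  then show "AE x in meas_I. norm (f x * g x) \<le> norm ((f x)\<^sup>2 + (g x)\<^sup>2)" by simp
qed

lemma
  assumes "f \<in> L2_I" "g \<in> L2_I"
  shows L2_I_diff: "(\<lambda>x. f x - g x) \<in> L2_I"
    and LINT_square_diff: "(LINT x|meas_I. (f x - g x)\<^sup>2) =
      (LINT x|meas_I. (f x)\<^sup>2) - 2 * (LINT x|meas_I. f x * g x) + (LINT x|meas_I. (g x)\<^sup>2)"
proof -
  have eq: "(\<lambda>x. (f x - g x)\<^sup>2) = (\<lambda>x. (f x)\<^sup>2 - 2 * (f x * g x) + (g x)\<^sup>2)"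
    by (simp add: power2_diff fun_eq_iff)
  have i: "integrable meas_I (\<lambda>x. (f x)\<^sup>2)" "integrable meas_I (\<lambda>x. (g x)\<^sup>2)"
    "integrable meas_I (\<lambda>x. 2 * (f x * g x))"
    using assms L2_I_mult[OF assms] by (auto simp: L2_I_def)
  show "(\<lambda>x. f x - g x) \<in> L2_I"
    using assms i by (simp add: L2_I_def eq)
  show "(LINT x|meas_I. (f x - g x)\<^sup>2) =
      (LINT x|meas_I. (f x)\<^sup>2) - 2 * (LINT x|meas_I. f x * g x) + (LINT x|meas_I. (g x)\<^sup>2)"
    using i unfolding eq by (subst Bochner_Integration.integral_add Bochner_Integration.integral_diff; simp)+
qed

lemma continuous_on_imp_L2_I:
  assumes "continuous_on {-1..1} f"
  shows "f \<in> L2_I"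
  using integrable_lebesgue_on_open_interval_continuous[OF assms]
    integrable_lebesgue_on_open_interval_continuous[of "-1" 1 "\<lambda>x. (f x)\<^sup>2"] assms
  by (auto simp: L2_I_def intro!: borel_measurable_integrable continuous_intros)

context
  fixes \<phi> assumes test: "\<phi> \<in> test_functions_I"
begin

lemma test_has_derivative: "((deriv ^^ n) \<phi> has_real_derivative (deriv ^^ Suc n) \<phi> x) (at x)"
  using test by (auto simp: test_functions_I_def DERIV_deriv_iff_real_differentiable)

lemma test_continuous_on: "continuous_on S ((deriv ^^ n) \<phi>)"
  by (rule DERIV_continuous_on[OF has_field_derivative_at_within[OF test_has_derivative]])

text \<open>Lets the derivative of an approximating test function serve as a test function in the
  definition of the weak derivative.\<close>

lemma test_deriv: "deriv \<phi> \<in> test_functions_I"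
proof -
  obtain K where K: "compact K" "K \<subseteq> interval_I" "\<And>x. x \<notin> K \<Longrightarrow> \<phi> x = 0"
    using test by (auto simp: test_functions_I_def)
  have "deriv \<phi> x = 0" if "x \<notin> K" for x
  proof -
    have "((\<lambda>_. 0) has_real_derivative 0) (at x)" by simp
    then have "(\<phi> has_real_derivative 0) (at x)"
      by (rule has_field_derivative_transform_within_open[of _ _ _ "- K"])
        (use that K compact_imp_closed in auto)
    then show ?thesis by (rule DERIV_imp_deriv)
  qed
  moreover have "(deriv ^^ n) (deriv \<phi>) differentiable (at x)" for n x
  proof -
    have "(deriv ^^ Suc n) \<phi> differentiable (at x)" using test unfolding test_functions_I_def by blast
    then show ?thesis by (simp only: funpow_Suc_right o_def)
  qed
  ultimately show ?thesis unfolding test_functions_I_def using K(1,2) by blast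
qed

lemma test_boundary: "\<phi> (-1) = 0" "\<phi> 1 = 0"
  using test by (auto simp: test_functions_I_def)

lemma test_cmult: "(\<lambda>x. c * \<phi> x) \<in> test_functions_I"
proof -
  have "(deriv ^^ n) (\<lambda>x. c * \<phi> x) = (\<lambda>x. c * (deriv ^^ n) \<phi> x)" for n
  proof (induction n)
    case (Suc n)
    have "deriv (\<lambda>x. c * (deriv ^^ n) \<phi> x) x = c * (deriv ^^ Suc n) \<phi> x" for x
      by (intro DERIV_imp_deriv DERIV_cmult test_has_derivative)
    then show ?case by (intro ext) (simp only: funpow.simps o_apply Suc.IH)
  qed simp
  then have "(deriv ^^ n) (\<lambda>x. c * \<phi> x) differentiable (at x)" for n x
    using DERIV_cmult[OF test_has_derivative[of n x], of c] by (auto simp: real_differentiable_def)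
  moreover obtain K where K: "compact K" "K \<subseteq> interval_I" "\<And>x. x \<notin> K \<Longrightarrow> \<phi> x = 0"
    using test by (auto simp: test_functions_I_def)
  moreover have "c * \<phi> x = 0" if "x \<notin> K" for x
    using K(3)[OF that] by simp
  ultimately show ?thesis
    unfolding test_functions_I_def by (intro CollectI conjI allI exI[of _ K] impI)
qed

lemma test_deriv_cmult: "deriv (\<lambda>x. c * \<phi> x) = (\<lambda>x. c * deriv \<phi> x)"
  by (intro ext DERIV_imp_deriv DERIV_cmult) (use test_has_derivative[of 0] in simp)

lemma test_L2: "(deriv ^^ n) \<phi> \<in> L2_I"
  by (rule continuous_on_imp_L2_I[OF test_continuous_on])

lemma test_sharp_bound:
  assumes "r \<ge> 2"
  shows "best_const r * (LINT x|meas_I. \<bar>\<phi> x\<bar> powr r)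
    \<le> (LINT x|meas_I. (deriv \<phi> x)\<^sup>2) powr (r / 2)"
proof -
  have "(LINT x|meas_I. \<bar>\<phi> x\<bar> powr r) = integral {-1..1} (\<lambda>x. \<bar>\<phi> x\<bar> powr r)"
    using test_continuous_on[of _ 0] assms
    by (intro LINT_open_interval_continuous continuous_on_powr' continuous_on_rabs) auto
  moreover have "(LINT x|meas_I. (deriv \<phi> x)\<^sup>2) = integral {-1..1} (\<lambda>x. (deriv \<phi> x)\<^sup>2)"
    using test_continuous_on[of _ 1] by (intro LINT_open_interval_continuous continuous_intros) auto
  moreover have "best_const r * integral {-1..1} (\<lambda>x. \<bar>\<phi> x\<bar> powr r)
    \<le> (integral {-1..1} (\<lambda>x. (deriv \<phi> x)\<^sup>2)) powr (r / 2)"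
  proof (rule dirichlet_lower_bound[OF assms])
    show "(\<phi> has_real_derivative deriv \<phi> x) (at x within {-1..1})" for x
      using test_has_derivative[of 0 x] by (auto intro: has_field_derivative_at_within)
    show "continuous_on {-1..1} (deriv \<phi>)" using test_continuous_on[of _ 1] by simp
  qed (fact test_boundary)+
  ultimately show ?thesis by simp
qed

end

lemma test_H1_deriv:
  assumes "\<phi> \<in> test_functions_I"
  shows "H1_deriv_I \<phi> (deriv \<phi>)"
  unfolding H1_deriv_I_def
proof (intro conjI ballI)
  show "\<phi> \<in> L2_I" "deriv \<phi> \<in> L2_I"
    using test_L2[OF assms, of 0] test_L2[OF assms, of 1] by simp_all
  fix \<psi> assume \<psi>: "\<psi> \<in> test_functions_I"
  note c = test_continuous_on[OF assms, of _ 0] test_continuous_on[OF assms, of _ 1]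
    test_continuous_on[OF \<psi>, of _ 0] test_continuous_on[OF \<psi>, of _ 1]
  have "((\<lambda>x. \<phi> x * deriv \<psi> x + deriv \<phi> x * \<psi> x) has_integral (\<phi> 1 * \<psi> 1 - \<phi> (-1) * \<psi> (-1))) {-1..1}"
  proof (rule fundamental_theorem_of_calculus[where f = "\<lambda>x. \<phi> x * \<psi> x"])
    fix x :: real
    have "((\<lambda>x. \<phi> x * \<psi> x) has_real_derivative \<phi> x * deriv \<psi> x + deriv \<phi> x * \<psi> x) (at x within {-1..1})"
      using has_field_derivative_at_within[OF
          DERIV_mult'[OF test_has_derivative[OF assms, of 0 x] test_has_derivative[OF \<psi>, of 0 x]],
          of "{-1..1}"]
      by simp
    then show "((\<lambda>x. \<phi> x * \<psi> x) has_vector_derivative \<phi> x * deriv \<psi> x + deriv \<phi> x * \<psi> x) (at x within {-1..1})"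
      by (simp add: has_real_derivative_iff_has_vector_derivative)
  qed simp
  then have "integral {-1..1} (\<lambda>x. \<phi> x * deriv \<psi> x + deriv \<phi> x * \<psi> x) = 0"
    by (simp add: test_boundary[OF assms] integral_unique)
  then have "integral {-1..1} (\<lambda>x. \<phi> x * deriv \<psi> x) + integral {-1..1} (\<lambda>x. deriv \<phi> x * \<psi> x) = 0"
    using c Henstock_Kurzweil_Integration.integral_add[of "\<lambda>x. \<phi> x * deriv \<psi> x" "{-1..1}" "\<lambda>x. deriv \<phi> x * \<psi> x"]
    by (simp add: integrable_continuous_real continuous_on_mult)
  moreover have "(LINT x|meas_I. \<phi> x * deriv \<psi> x) = integral {-1..1} (\<lambda>x. \<phi> x * deriv \<psi> x)"
    "(LINT x|meas_I. deriv \<phi> x * \<psi> x) = integral {-1..1} (\<lambda>x. deriv \<phi> x * \<psi> x)"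
    using c by (simp_all add: LINT_open_interval_continuous continuous_on_mult)
  ultimately show "(LINT x|meas_I. \<phi> x * deriv \<psi> x) = - (LINT x|meas_I. deriv \<phi> x * \<psi> x)" by simp
qed

lemma test_H01: "\<phi> \<in> test_functions_I \<Longrightarrow> \<phi> \<in> H01_I"
  unfolding H01_I_def
  by (auto intro!: exI[of _ "deriv \<phi>"] exI[of _ "\<lambda>_. \<phi>"] test_H1_deriv simp: L2_norm_I_def)

section \<open>The upper bound for the first eigenvalue\<close>

definition energies :: "real \<Rightarrow> real set" where
  "energies p = {L2_norm_I g powr (p + 1) | u g. u \<in> H01_I \<and> H1_deriv_I u g \<and>
     (LINT x|meas_I. \<bar>u x\<bar> powr (p + 1)) = 1}"

text \<open>The quotient is invariant under scaling, so multiplying by the constant that normalizes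
  the denominator produces an admissible competitor with this energy.\<close>

lemma quotient_in_energies:
  assumes \<phi>: "\<phi> \<in> test_functions_I" and r: "p + 1 > 0"
    and J: "(LINT x|meas_I. \<bar>\<phi> x\<bar> powr (p + 1)) > 0"
  shows "(LINT x|meas_I. (deriv \<phi> x)\<^sup>2) powr ((p + 1) / 2) / (LINT x|meas_I. \<bar>\<phi> x\<bar> powr (p + 1)) \<in> energies p"
proof -
  let ?J = "LINT x|meas_I. \<bar>\<phi> x\<bar> powr (p + 1)" and ?D = "LINT x|meas_I. (deriv \<phi> x)\<^sup>2"
  define c where "c = ?J powr (- 1 / (p + 1))"
  define u where "u x = c * \<phi> x" for x
  have c: "c > 0" using J by (simp add: c_def)
  have "c powr (p + 1) = ?J powr (- 1 / (p + 1) * (p + 1))" by (simp only: c_def powr_powr)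
  also have "- 1 / (p + 1) * (p + 1) = - 1" using r by simp
  finally have cJ: "c powr (p + 1) = 1 / ?J" using J by (simp add: powr_neg_one)
  have u: "u \<in> test_functions_I" unfolding u_def[abs_def] by (rule test_cmult[OF \<phi>])
  have du: "deriv u x = c * deriv \<phi> x" for x
    unfolding u_def[abs_def] by (simp add: test_deriv_cmult[OF \<phi>])
  have "(LINT x|meas_I. \<bar>u x\<bar> powr (p + 1)) = c powr (p + 1) * ?J"
    using c by (simp add: u_def abs_mult powr_mult)
  then have u1: "(LINT x|meas_I. \<bar>u x\<bar> powr (p + 1)) = 1" using cJ J by simp
  have "L2_norm_I (deriv u) powr (p + 1) \<in> energies p"
    unfolding energies_def using u u1 test_H01 test_H1_deriv by blast
  also have "L2_norm_I (deriv u) powr (p + 1) = (c\<^sup>2 * ?D) powr ((p + 1) / 2)"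
    by (simp add: L2_norm_I_powr du power_mult_distrib)
  also have "\<dots> = c powr (p + 1) * ?D powr ((p + 1) / 2)"
  proof -
    have "(c\<^sup>2) powr ((p + 1) / 2) = (c powr 2) powr ((p + 1) / 2)" using c by simp
    also have "\<dots> = c powr (2 * ((p + 1) / 2))" by (simp only: powr_powr)
    also have "2 * ((p + 1) / 2) = p + 1" by (simp add: field_simps)
    finally show ?thesis by (simp add: powr_mult Bochner_Integration.integral_nonneg)
  qed
  finally show ?thesis by (simp add: cJ)
qed

text \<open>Test functions whose derivatives approximate \<open>profile_slope\<close> have quotients
  converging to \<open>best_const\<close>, and each quotient with positive denominator bounds the
  infimum from above. Nonemptiness is recorded because the greatest lower bound property of
  \<open>Inf\<close> on the reals requires it.\<close>

lemma mu1_le_best_const: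
  assumes p: "p > 1"
  shows "mu1 p \<le> best_const (p + 1)" "energies p \<noteq> {}"
proof -
  define r where "r = p + 1"
  have r: "r \<ge> 2" "r \<ge> 1" "r > 0" using p by (auto simp: r_def)
  obtain \<psi> M where \<psi>: "\<And>n. \<psi> n \<in> test_functions_I"
    "\<And>n x. x \<in> {-1..1} \<Longrightarrow> \<bar>deriv (\<psi> n) x\<bar> \<le> M"
    "\<And>x. x \<in> interval_I \<Longrightarrow> (\<lambda>n. deriv (\<psi> n) x) \<longlonglongrightarrow> profile_slope r x"
    "\<And>n. continuous_on {-1..1} (deriv (\<psi> n))"
    "\<And>n x. \<psi> n x = integral {-1..x} (deriv (\<psi> n))"
    by (rule test_functions_approximation[OF continuous_on_profile_slope[OF r(2)]
        integral_profile_slope[OF r(2)]]) (rule that, assumption+)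
  have dI: "deriv (\<psi> n) integrable_on {-1..x}" if "x \<in> interval_I" for n x
    using that \<psi>(4) by (intro integrable_continuous_real continuous_on_subset[OF \<psi>(4)]) auto
  have lim: "(\<lambda>n. \<psi> n x) \<longlonglongrightarrow> profile r x" if x: "x \<in> interval_I" for x
  proof -
    \<comment> \<open>Open intervals are used because the derivatives are known to converge only in
      the interior.\<close>
    have "(\<lambda>n. integral {-1<..<x} (deriv (\<psi> n))) \<longlonglongrightarrow> integral {-1<..<x} (profile_slope r)"
    proof (rule dominated_convergence(2)[where h = "\<lambda>_. M"])
      show "deriv (\<psi> n) integrable_on {-1<..<x}" for n
        using dI[OF x] by (simp add: integrable_on_open_interval_real)
    qed (use \<psi>(2,3) x in \<open>auto simp: integrable_on_open_interval_real integrable_const_ivl\<close>)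
    then show ?thesis
      using integral_unique[OF has_integral_profile_slope[OF r(2), of x]] x
      unfolding integral_open_interval_real[symmetric] \<psi>(5)[symmetric] by simp
  qed
  have bnd: "\<bar>\<psi> n x\<bar> \<le> 2 * M" if "x \<in> interval_I" for n x
  proof -
    have M: "0 \<le> M" using \<psi>(2)[of 0 0] by simp
    have "\<bar>integral {-1..x} (deriv (\<psi> n))\<bar> \<le> M * (x - (-1))"
    proof -
      have "norm (integral {-1..x} (deriv (\<psi> n))) \<le> M * (x - (-1))"
      proof (rule integral_bound)
        show "continuous_on {-1..x} (deriv (\<psi> n))"
          using that by (intro continuous_on_subset[OF \<psi>(4)]) auto
        show "norm (deriv (\<psi> n) t) \<le> M" if "t \<in> {-1..x}" for t
          using \<psi>(2)[of t n] that \<open>x \<in> interval_I\<close> by simp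
      qed (use that in simp)
      then show ?thesis by simp
    qed
    also have "\<dots> \<le> M * 2" by (rule mult_left_mono) (use that M in auto)
    finally show ?thesis using \<psi>(5)[of n x] by (metis mult.commute)
  qed
  define D where "D n = integral {-1..1} (\<lambda>x. (deriv (\<psi> n) x)\<^sup>2)" for n
  define J where "J n = integral {-1..1} (\<lambda>x. \<bar>\<psi> n x\<bar> powr r)" for n
  have c\<psi>: "continuous_on {-1..1} (\<lambda>x. \<bar>\<psi> n x\<bar> powr r)" for n
    using test_continuous_on[OF \<psi>(1), of _ 0] r by (intro continuous_on_powr' continuous_on_rabs) auto
  have cd: "continuous_on {-1..1} (\<lambda>x. (deriv (\<psi> n) x)\<^sup>2)" for n
    using \<psi>(4) by (intro continuous_intros)
  have "(\<lambda>n. integral {-1<..<1} (\<lambda>x. (deriv (\<psi> n) x)\<^sup>2)) \<longlonglongrightarrow> integral {-1<..<1} (\<lambda>x. (profile_slope r x)\<^sup>2)"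
  proof (rule dominated_convergence(2)[where h = "\<lambda>_. M\<^sup>2"])
    show "(\<lambda>x. (deriv (\<psi> n) x)\<^sup>2) integrable_on {-1<..<1}" for n
      using integrable_continuous_real[OF cd] by (simp add: integrable_on_open_interval_real)
    show "norm ((deriv (\<psi> n) x)\<^sup>2) \<le> M\<^sup>2" if "x \<in> {-1<..<1}" for n x
      using \<psi>(2)[of x n] that by (simp add: abs_le_square_iff[symmetric])
  qed (auto simp: integrable_on_open_interval_real integrable_const_ivl intro!: tendsto_power \<psi>(3))
  then have D: "D \<longlonglongrightarrow> 2 * gen_arcsin r 1 * area r 1"
    unfolding D_def[abs_def] integral_open_interval_real[symmetric] integral_profile_slope_square[OF r(2)] .
  have "(\<lambda>n. integral {-1<..<1} (\<lambda>x. \<bar>\<psi> n x\<bar> powr r)) \<longlonglongrightarrow> integral {-1<..<1} (\<lambda>x. profile r x powr r)"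
  proof (rule dominated_convergence(2)[where h = "\<lambda>_. (2 * M) powr r"])
    show "(\<lambda>x. \<bar>\<psi> n x\<bar> powr r) integrable_on {-1<..<1}" for n
      using integrable_continuous_real[OF c\<psi>] by (simp add: integrable_on_open_interval_real)
    show "norm (\<bar>\<psi> n x\<bar> powr r) \<le> (2 * M) powr r" if "x \<in> {-1<..<1}" for n x
      using bnd[OF that, of n] r by (auto intro!: powr_mono2)
    show "(\<lambda>n. \<bar>\<psi> n x\<bar> powr r) \<longlonglongrightarrow> profile r x powr r" if "x \<in> {-1<..<1}" for x
    proof -
      have "(\<lambda>n. \<bar>\<psi> n x\<bar> powr r) \<longlonglongrightarrow> \<bar>profile r x\<bar> powr r"
        by (intro tendsto_powr' tendsto_rabs lim[OF that] tendsto_const) (use r in auto)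
      then show ?thesis using profile_in[OF r(2), of x] that by auto
    qed
  qed (simp add: integrable_on_open_interval_real integrable_const_ivl)
  then have J: "J \<longlonglongrightarrow> 4 / (r + 2)"
    unfolding J_def[abs_def] integral_open_interval_real[symmetric] integral_profile_powr[OF r(2)] .
  have "\<forall>\<^sub>F n in sequentially. J n > 0"
    using order_tendstoD(1)[OF J, of 0] r by simp
  then have mem: "\<forall>\<^sub>F n in sequentially. D n powr (r / 2) / J n \<in> energies p"
  proof (rule eventually_mono)
    fix n assume n: "J n > 0"
    have "(LINT x|meas_I. \<bar>\<psi> n x\<bar> powr (p + 1)) = J n" "(LINT x|meas_I. (deriv (\<psi> n) x)\<^sup>2) = D n"
      unfolding J_def D_def r_def[symmetric] by (intro LINT_open_interval_continuous c\<psi> cd)+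
    then show "D n powr (r / 2) / J n \<in> energies p"
      using quotient_in_energies[OF \<psi>(1)[of n], of p] n p by (simp add: r_def)
  qed
  then show "energies p \<noteq> {}" by (auto simp: eventually_sequentially)
  have "bdd_below (energies p)" by (rule bdd_belowI[of _ 0]) (auto simp: energies_def)
  then have ev: "\<forall>\<^sub>F n in sequentially. mu1 p \<le> D n powr (r / 2) / J n"
    using mem unfolding mu1_def energies_def[symmetric] by (auto elim!: eventually_mono intro: cInf_lower)
  have "(\<lambda>n. D n powr (r / 2) / J n) \<longlonglongrightarrow> (2 * gen_arcsin r 1 * area r 1) powr (r / 2) / (4 / (r + 2))"
    using gen_arcsin_1_pos[OF r(2)] area_1_pos[OF r(2)] r by (intro tendsto_intros D J) auto
  then have "mu1 p \<le> (2 * gen_arcsin r 1 * area r 1) powr (r / 2) / (4 / (r + 2))"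
    by (rule tendsto_lowerbound[OF _ ev]) simp
  then show "mu1 p \<le> best_const (p + 1)" by (simp add: best_const_def r_def)
qed

section \<open>The lower bound on the Sobolev space\<close>

text \<open>Fatou's lemma, passed through extended nonnegative integrals. Nonnegativity of
  \<open>K\<close> is established first so that the bound survives the conversion, which sends
  negative numbers to 0.\<close>

lemma LINT_le_of_AE_subseq_limit:
  fixes u :: "'a \<Rightarrow> real"
  assumes int: "integrable M u" and u: "\<And>x. 0 \<le> u x"
    and f: "\<And>n. integrable M (f n)" "\<And>n x. 0 \<le> f n x"
    and lim: "AE x in M. (\<lambda>n. f n x) \<longlonglongrightarrow> u x"
    and K: "\<forall>\<^sub>F n in sequentially. (LINT x|M. f n x) \<le> K"
  shows "(LINT x|M. u x) \<le> K"
proof -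
  have K0: "0 \<le> K"
  proof -
    obtain n where "(LINT x|M. f n x) \<le> K" using K by (auto simp: eventually_sequentially)
    moreover have "0 \<le> (LINT x|M. f n x)" by (rule Bochner_Integration.integral_nonneg) (rule f(2))
    ultimately show ?thesis by linarith
  qed
  have "ennreal (LINT x|M. u x) = (\<integral>\<^sup>+x. ennreal (u x) \<partial>M)"
    by (rule nn_integral_eq_integral[symmetric]) (use int u in auto)
  also have "\<dots> = (\<integral>\<^sup>+x. liminf (\<lambda>n. ennreal (f n x)) \<partial>M)"
  proof (rule nn_integral_cong_AE, use lim in eventually_elim)
    fix x assume "(\<lambda>n. f n x) \<longlonglongrightarrow> u x"
    then have "(\<lambda>n. ennreal (f n x)) \<longlonglongrightarrow> ennreal (u x)" by (rule tendsto_ennrealI)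
    then show "ennreal (u x) = liminf (\<lambda>n. ennreal (f n x))"
      by (rule lim_imp_Liminf[OF sequentially_bot, symmetric])
  qed
  also have "\<dots> \<le> liminf (\<lambda>n. \<integral>\<^sup>+x. ennreal (f n x) \<partial>M)"
    by (rule nn_integral_liminf) (use borel_measurable_integrable[OF f(1)] in measurable)
  also have "\<dots> \<le> limsup (\<lambda>n. \<integral>\<^sup>+x. ennreal (f n x) \<partial>M)"
    by (rule Liminf_le_Limsup) simp
  also have "\<dots> \<le> ennreal K"
  proof (rule Limsup_bounded, use K in eventually_elim)
    fix n assume n: "(LINT x|M. f n x) \<le> K"
    have "(\<integral>\<^sup>+x. ennreal (f n x) \<partial>M) = ennreal (LINT x|M. f n x)"
      by (rule nn_integral_eq_integral) (use f in auto)
    then show "(\<integral>\<^sup>+x. ennreal (f n x) \<partial>M) \<le> ennreal K" using n by (simp add: ennreal_leI)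
  qed
  finally show ?thesis using K0 by simp
qed

text \<open>The difference of the two sides is \<open>(e * a - b)\<^sup>2 / e\<close>. A small
  weight \<open>e\<close> keeps the coefficient of the main term close to 1.\<close>

lemma weighted_square_add_le:
  fixes a b e :: real
  assumes "e > 0"
  shows "(a + b)\<^sup>2 \<le> (1 + e) * a\<^sup>2 + (1 + 1 / e) * b\<^sup>2"
proof -
  have "0 \<le> (e * a - b)\<^sup>2 / e" using assms by simp
  also have "\<dots> = e * a\<^sup>2 + b\<^sup>2 / e - 2 * a * b"
    using assms by (simp add: power2_eq_square field_simps)
  finally show ?thesis by (simp add: power2_sum algebra_simps)
qed

lemma LINT_square_le:
  assumes f: "f \<in> L2_I" and g: "g \<in> L2_I" and e: "e > 0"
  shows "(LINT x|meas_I. (f x)\<^sup>2) \<le>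
    (1 + e) * (LINT x|meas_I. (g x)\<^sup>2) + (1 + 1 / e) * (LINT x|meas_I. (f x - g x)\<^sup>2)"
proof -
  have i: "integrable meas_I (\<lambda>x. (f x)\<^sup>2)" "integrable meas_I (\<lambda>x. (g x)\<^sup>2)"
    "integrable meas_I (\<lambda>x. (f x - g x)\<^sup>2)"
    using f g L2_I_diff[OF f g] by (auto simp: L2_I_def)
  have "(LINT x|meas_I. (f x)\<^sup>2) \<le> (LINT x|meas_I. (1 + e) * (g x)\<^sup>2 + (1 + 1 / e) * (f x - g x)\<^sup>2)"
    using weighted_square_add_le[OF e, of "g x" "f x - g x" for x] i
    by (intro Bochner_Integration.integral_mono) auto
  also have "\<dots> = (1 + e) * (LINT x|meas_I. (g x)\<^sup>2) + (1 + 1 / e) * (LINT x|meas_I. (f x - g x)\<^sup>2)"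
    using i by simp
  finally show ?thesis .
qed

text \<open>The derivatives of the approximating test functions converge to some weak derivative
  \<open>h\<close>, possibly not the given \<open>g\<close>; comparing norms replaces an appeal to
  uniqueness of weak derivatives. Fatou's lemma along an almost everywhere convergent subsequence
  then carries over the bound for test functions.\<close>

lemma best_const_le_dirichlet:
  assumes p: "p > 1" and u: "u \<in> H01_I" and ug: "H1_deriv_I u g"
    and norm: "(LINT x|meas_I. \<bar>u x\<bar> powr (p + 1)) = 1"
  shows "best_const (p + 1) \<le> L2_norm_I g powr (p + 1)"
proof -
  define r where "r = p + 1"
  have r: "r \<ge> 2" "r > 0" using p by (auto simp: r_def)
  obtain h \<phi> where h: "H1_deriv_I u h" and \<phi>: "\<And>n. \<phi> n \<in> test_functions_I"
    and lim: "(\<lambda>n. sqrt ((L2_norm_I (\<lambda>x. \<phi> n x - u x))\<^sup>2 +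
                    (L2_norm_I (\<lambda>x. deriv (\<phi> n) x - h x))\<^sup>2)) \<longlonglongrightarrow> 0"
    using u by (auto simp: H01_I_def)
  have L2: "u \<in> L2_I" "g \<in> L2_I" "h \<in> L2_I" using h ug by (auto simp: H1_deriv_I_def)
  have \<phi>L2: "\<phi> n \<in> L2_I" "deriv (\<phi> n) \<in> L2_I" for n
    using test_L2[OF \<phi>, of 0 n] test_L2[OF \<phi>, of 1 n] by simp_all
  define a where "a n = (LINT x|meas_I. (\<phi> n x - u x)\<^sup>2)" for n
  define b where "b n = (LINT x|meas_I. (deriv (\<phi> n) x - h x)\<^sup>2)" for n
  define D where "D n = (LINT x|meas_I. (deriv (\<phi> n) x)\<^sup>2)" for n
  define G where "G = (LINT x|meas_I. (g x)\<^sup>2)"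
  define H where "H = (LINT x|meas_I. (h x)\<^sup>2)"
  have a0: "a n \<ge> 0" and b0: "b n \<ge> 0" for n
    by (auto simp: a_def b_def intro: Bochner_Integration.integral_nonneg)
  have "(\<lambda>n. (sqrt (a n + b n))\<^sup>2) \<longlonglongrightarrow> 0\<^sup>2"
    using tendsto_power[OF lim, of 2] by (simp add: L2_norm_I_square a_def b_def)
  then have ab: "(\<lambda>n. a n + b n) \<longlonglongrightarrow> 0" using a0 b0 by simp
  have alim: "a \<longlonglongrightarrow> 0"
    by (rule tendsto_sandwich[OF _ _ tendsto_const ab]) (use a0 b0 in auto)
  have blim: "b \<longlonglongrightarrow> 0"
    by (rule tendsto_sandwich[OF _ _ tendsto_const ab]) (use a0 b0 in auto)
  \<comment> \<open>Expanding \<open>b n\<close> gives \<open>H - b n\<close> as twice the pairing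
    of \<open>h\<close> with \<open>deriv (\<phi> n)\<close>, minus the squared norm of
    \<open>deriv (\<phi> n)\<close>. The same expression with \<open>g\<close> is at most
    \<open>G\<close>, since the square of \<open>g x - deriv (\<phi> n) x\<close> has nonnegative
    integral.\<close>
  have "H - b n \<le> G" for n
  proof -
    have d: "deriv (\<phi> n) \<in> test_functions_I" by (rule test_deriv[OF \<phi>])
    \<comment> \<open>Both weak derivatives of \<open>u\<close> have the same pairing with the test function \<open>deriv (\<phi> n)\<close>.\<close>
    have "(LINT x|meas_I. g x * deriv (\<phi> n) x) = (LINT x|meas_I. h x * deriv (\<phi> n) x)"
    proof -
      have "(LINT x|meas_I. u x * deriv (deriv (\<phi> n)) x) = - (LINT x|meas_I. w x * deriv (\<phi> n) x)"
        if "H1_deriv_I u w" for w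
        using that d unfolding H1_deriv_I_def by blast
      from this[OF h] this[OF ug] show ?thesis by linarith
    qed
    moreover have "(LINT x|meas_I. deriv (\<phi> n) x * h x) = (LINT x|meas_I. h x * deriv (\<phi> n) x)"
      by (simp add: mult.commute)
    moreover have "0 \<le> (LINT x|meas_I. (g x - deriv (\<phi> n) x)\<^sup>2)"
      by (auto intro: Bochner_Integration.integral_nonneg)
    ultimately show ?thesis
      using LINT_square_diff[OF L2(2) \<phi>L2(2)[of n]] LINT_square_diff[OF \<phi>L2(2)[of n] L2(3)]
      by (simp add: G_def H_def b_def)
  qed
  then have "\<forall>n. H \<le> G + b n" by (simp add: algebra_simps)
  moreover have "(\<lambda>n. G + b n) \<longlonglongrightarrow> G + 0" by (intro tendsto_intros blim)
  ultimately have HG: "H \<le> G" by (intro tendsto_lowerbound[of _ G sequentially]) auto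
  have H0: "H \<ge> 0" by (auto simp: H_def intro: Bochner_Integration.integral_nonneg)

  obtain s :: "nat \<Rightarrow> nat" where s: "strict_mono s"
    and sq: "AE x in meas_I. (\<lambda>n. (\<phi> (s n) x - u x)\<^sup>2) \<longlonglongrightarrow> 0"
  proof -
    have "\<exists>s::nat\<Rightarrow>nat. strict_mono s \<and> (AE x in meas_I. (\<lambda>n. (\<phi> (s n) x - u x)\<^sup>2) \<longlonglongrightarrow> 0)"
    proof (rule tendsto_L1_AE_subseq)
      show "integrable meas_I (\<lambda>x. (\<phi> n x - u x)\<^sup>2)" for n
        using L2_I_diff[OF \<phi>L2(1) L2(1), of n] by (simp add: L2_I_def)
      show "(\<lambda>n. LINT x|meas_I. norm ((\<phi> n x - u x)\<^sup>2)) \<longlonglongrightarrow> 0"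
        using alim by (simp add: a_def[abs_def])
    qed
    then show ?thesis using that by blast
  qed
  from sq have ae: "AE x in meas_I. (\<lambda>n. \<bar>\<phi> (s n) x\<bar> powr r) \<longlonglongrightarrow> \<bar>u x\<bar> powr r"
  proof eventually_elim
    fix x assume "(\<lambda>n. (\<phi> (s n) x - u x)\<^sup>2) \<longlonglongrightarrow> 0"
    then have "(\<lambda>n. sqrt ((\<phi> (s n) x - u x)\<^sup>2)) \<longlonglongrightarrow> sqrt 0" by (rule tendsto_real_sqrt)
    then have "(\<lambda>n. \<phi> (s n) x - u x) \<longlonglongrightarrow> 0" by (simp add: tendsto_rabs_zero_iff)
    then have "(\<lambda>n. \<phi> (s n) x) \<longlonglongrightarrow> u x" by (simp add: LIM_zero_iff)
    then show "(\<lambda>n. \<bar>\<phi> (s n) x\<bar> powr r) \<longlonglongrightarrow> \<bar>u x\<bar> powr r"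
      using r by (intro tendsto_powr' tendsto_rabs tendsto_const) auto
  qed
  have main: "best_const r \<le> T powr (r / 2)" if T: "T > G" for T
  proof -
    \<comment> \<open>Half of the gap between \<open>H\<close> and \<open>T\<close> is spent on
      \<open>e * H\<close>, the other half on the error \<open>b n\<close>. The summand 1 prevents
      division by zero when \<open>H = 0\<close>.\<close>
    define e where "e = (T - H) / (2 * (H + 1))"
    have TH: "T > H" using T HG by simp
    have e: "e > 0" using TH H0 by (simp add: e_def)
    have eH: "(1 + e) * H \<le> H + (T - H) / 2"
    proof -
      have "e * H \<le> e * (H + 1)" using e by simp
      also have "\<dots> = (T - H) / 2" using H0 by (simp add: e_def field_simps)
      finally show ?thesis by (simp add: algebra_simps)
    qed
    have "(\<lambda>n. (1 + 1 / e) * b n) \<longlonglongrightarrow> (1 + 1 / e) * 0" by (intro tendsto_intros blim)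
    then have "\<forall>\<^sub>F n in sequentially. (1 + 1 / e) * b n < (T - H) / 2"
      using TH by (intro order_tendstoD(2)) auto
    then have "\<forall>\<^sub>F n in sequentially. D n \<le> T"
    proof eventually_elim
      fix n assume n: "(1 + 1 / e) * b n < (T - H) / 2"
      have "D n \<le> (1 + e) * H + (1 + 1 / e) * b n"
        unfolding D_def H_def b_def by (rule LINT_square_le[OF \<phi>L2(2) L2(3) e])
      also have "\<dots> \<le> (H + (T - H) / 2) + (T - H) / 2"
        using eH n by (intro add_mono) auto
      finally show "D n \<le> T" by simp
    qed
    then have "\<forall>\<^sub>F n in sequentially. (LINT x|meas_I. \<bar>\<phi> n x\<bar> powr r) \<le> T powr (r / 2) / best_const r"
    proof eventually_elim
      fix n assume "D n \<le> T"
      then have "D n powr (r / 2) \<le> T powr (r / 2)"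
        using r by (intro powr_mono2) (auto simp: D_def intro: Bochner_Integration.integral_nonneg)
      then have "best_const r * (LINT x|meas_I. \<bar>\<phi> n x\<bar> powr r) \<le> T powr (r / 2)"
        using test_sharp_bound[OF \<phi>[of n] r(1)] unfolding D_def by linarith
      then show "(LINT x|meas_I. \<bar>\<phi> n x\<bar> powr r) \<le> T powr (r / 2) / best_const r"
        using best_const_pos[of r] r by (simp add: pos_le_divide_eq mult.commute)
    qed
    then have ev: "\<forall>\<^sub>F n in sequentially.
        (LINT x|meas_I. \<bar>\<phi> (s n) x\<bar> powr r) \<le> T powr (r / 2) / best_const r"
      by (rule eventually_subseq[OF s])
    have "(LINT x|meas_I. \<bar>u x\<bar> powr r) \<le> T powr (r / 2) / best_const r"
    proof (rule LINT_le_of_AE_subseq_limit[OF _ _ _ _ ae ev])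
      \<comment> \<open>A function that is not integrable has integral 0 by convention, so the
        normalization to 1 forces integrability.\<close>
      show "integrable meas_I (\<lambda>x. \<bar>u x\<bar> powr r)"
        using norm not_integrable_integral_eq[of meas_I] unfolding r_def by fastforce
      show "integrable meas_I (\<lambda>x. \<bar>\<phi> (s n) x\<bar> powr r)" for n
        using test_continuous_on[OF \<phi>, of _ 0] r
        by (intro integrable_lebesgue_on_open_interval_continuous continuous_on_powr' continuous_on_rabs) auto
    qed auto
    then show ?thesis
      using norm best_const_pos[of r] r by (simp add: r_def pos_le_divide_eq)
  qed
  \<comment> \<open>The slack between \<open>T\<close> and \<open>G\<close> is removed by letting
    \<open>T\<close> decrease to \<open>G\<close>.\<close>
  have "((\<lambda>T. T powr (r / 2)) \<longlongrightarrow> G powr (r / 2)) (at_right G)"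
    using r HG H0 by (intro tendsto_powr' tendsto_intros) (auto simp: eventually_at_right_field intro!: exI[of _ "G + 1"])
  then have "best_const r \<le> G powr (r / 2)"
    by (rule tendsto_lowerbound) (use main in \<open>auto simp: eventually_at_right_field intro!: exI[of _ "G + 1"]\<close>)
  then show ?thesis by (simp add: r_def L2_norm_I_powr G_def)
qed

lemma mu1_eq_best_const:
  assumes p: "p > 1"
  shows "mu1 p = best_const (p + 1)"
proof (rule antisym[OF mu1_le_best_const(1)[OF p]])
  show "best_const (p + 1) \<le> mu1 p"
    unfolding mu1_def energies_def[symmetric]
    by (rule cInf_greatest[OF mu1_le_best_const(2)[OF p]])
      (use best_const_le_dirichlet[OF p] in \<open>auto simp: energies_def\<close>)
qed

section \<open>The nonlinear boundary value problem\<close>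

text \<open>Conservation of energy makes \<open>gen_arcsin r (u x / M)\<close>, with
  \<open>r = p + 1\<close>, piecewise linear with slopes \<kappa> and -\<kappa>. It climbs from 0 to
  its value at the maximum and returns to 0, so the maximum lies at the centre and \<kappa> equals
  \<open>gen_arcsin r 1\<close>. This last equation ties the amplitude \<open>M\<close> to
  \<open>l\<close>.\<close>

lemma positive_solution_eq_profile:
  fixes p l :: real
  assumes p: "p > 1" and l: "l > 0" and u: "positive_dirichlet u"
    and ode: "\<And>x. x \<in> interval_I \<Longrightarrow> deriv (deriv u) x = - l * u x powr p"
  obtains M where "M > 0" "sqrt (2 * l / (p + 1)) * M powr ((p - 1) / 2) = gen_arcsin (p + 1) 1"
    "\<And>x. x \<in> {-1..1} \<Longrightarrow> u x = M * profile (p + 1) x"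
proof -
  define r where "r = p + 1"
  have r: "r \<ge> 1" "r > 2" using p by (auto simp: r_def)
  define v where "v = deriv u"
  define A where "A = gen_arcsin r 1"
  have A: "A > 0" using gen_arcsin_1_pos[OF r(1)] by (simp add: A_def)
  have cont: "continuous_on {-1..1} u" and upos: "\<And>x. x \<in> interval_I \<Longrightarrow> u x > 0"
    and bd: "u (-1) = 0" "u 1 = 0"
    using u by (auto simp: positive_dirichlet_def)
  have du: "(u has_real_derivative v x) (at x)" if "x \<in> interval_I" for x
    using u that by (auto simp: positive_dirichlet_def v_def DERIV_deriv_iff_real_differentiable)
  have dv: "(v has_real_derivative - l * u x powr p) (at x)" if "x \<in> interval_I" for x
    using u that ode[OF that]
    by (metis (no_types, lifting) DERIV_deriv_iff_real_differentiable positive_dirichlet_def v_def)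
  obtain x0 where x0: "x0 \<in> {-1..1}" "\<And>x. x \<in> {-1..1} \<Longrightarrow> u x \<le> u x0"
    using continuous_attains_sup[OF compact_Icc _ cont] by auto
  define M where "M = u x0"
  have M: "M > 0" using upos[of 0] x0(2)[of 0] by (simp add: M_def)
  have "x0 \<noteq> -1" "x0 \<noteq> 1" using M bd unfolding M_def by (metis less_irrefl)+
  then have x0I: "x0 \<in> interval_I" using x0(1) by auto
  define d where "d = min (x0 + 1) (1 - x0)"
  have "d > 0" using x0I by (simp add: d_def)
  have v0: "v x0 = 0"
    by (rule DERIV_local_max[OF du[OF x0I] \<open>d > 0\<close>]) (use x0(2) in \<open>auto simp: d_def abs_if split: if_splits\<close>)
  have v_decr: "v y < v x" if "x < y" "x \<in> interval_I" "y \<in> interval_I" for x y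
  proof (rule DERIV_neg_imp_decreasing[OF that(1)])
    fix z assume "x \<le> z" "z \<le> y"
    then have z: "z \<in> interval_I" using that by auto
    then show "\<exists>D. (v has_real_derivative D) (at z) \<and> D < 0"
      using dv[OF z] upos[OF z] l by (intro exI[of _ "- l * u z powr p"]) auto
  qed
  have v_pos: "v x > 0" if "x \<in> {-1<..<x0}" for x
    using v_decr[of x x0] that x0I v0 by auto
  have v_neg: "v x < 0" if "x \<in> {x0<..<1}" for x
    using v_decr[of x0 x] that x0I v0 by auto

  \<comment> \<open>The first integral obtained by multiplying the equation by \<open>2 * v\<close>.
    Its value is read off at the maximum, where \<open>v\<close> vanishes.\<close>
  have "\<exists>c. \<forall>x\<in>interval_I. (v x)\<^sup>2 + 2 * l / r * u x powr r = c"
  proof (rule has_field_derivative_zero_constant)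
    fix x :: real assume x: "x \<in> interval_I"
    have "((\<lambda>x. (v x)\<^sup>2 + 2 * l / r * u x powr r) has_real_derivative
        2 * v x * (- l * u x powr p) + 2 * l / r * (r * u x powr (r - 1) * v x)) (at x)"
      using upos[OF x] by (auto intro!: derivative_eq_intros du[OF x] dv[OF x])
    also have "2 * v x * (- l * u x powr p) + 2 * l / r * (r * u x powr (r - 1) * v x) = 0"
      using r by (simp add: r_def)
    finally show "((\<lambda>x. (v x)\<^sup>2 + 2 * l / r * u x powr r) has_real_derivative 0) (at x within interval_I)"
      by (rule has_field_derivative_at_within)
  qed simp
  then obtain c where c: "\<And>x. x \<in> interval_I \<Longrightarrow> (v x)\<^sup>2 + 2 * l / r * u x powr r = c" by blast
  have energy: "(v x)\<^sup>2 = 2 * l / r * (M powr r - u x powr r)" if "x \<in> interval_I" for x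
    using c[OF that] c[OF x0I] v0 by (simp add: M_def algebra_simps)
  \<comment> \<open>Chosen so that the energy identity reads
    \<open>\<bar>v x\<bar> = \<kappa> * M * sqrt (1 - (u x / M) powr r)\<close>; dividing by
    \<open>M\<close> and the root leaves a constant speed.\<close>
  define \<kappa> where "\<kappa> = sqrt (2 * l / r) * M powr ((p - 1) / 2)"
  define T where "T x = gen_arcsin r (u x / M)" for x
  have uM: "u x / M \<in> {0..1}" if "x \<in> {-1..1}" for x
  proof -
    have "u x \<ge> 0" using upos[of x] bd that by (cases "x = -1 \<or> x = 1") (auto simp: less_imp_le)
    then show ?thesis using x0(2)[OF that] M by (simp add: M_def)
  qed
  have T_cont: "continuous_on {-1..1} T"
    unfolding T_def[abs_def]
    by (rule continuous_on_compose2[OF continuous_on_gen_arcsin[OF r(1)]])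
      (use cont M uM in \<open>auto intro!: continuous_intros\<close>)
  have dT: "(T has_real_derivative sgn (v x) * \<kappa>) (at x)" if x: "x \<in> interval_I" "v x \<noteq> 0" for x
  proof -
    let ?s = "u x / M"
    have "(v x)\<^sup>2 > 0" using x by simp
    then have "u x \<noteq> M" unfolding energy[OF x(1)] by auto
    then have s: "0 < ?s" "?s < 1"
      using upos[OF x(1)] x0(2)[of x] x M by (auto simp: M_def)
    have lt: "?s powr r < 1" using powr_less_one_base[of ?s r] s r by simp
    have "M powr r * (1 - ?s powr r) = M powr r - u x powr r"
      using M upos[OF x(1)] by (simp add: powr_divide right_diff_distrib)
    then have "(v x)\<^sup>2 = 2 * l / r * M powr r * (1 - ?s powr r)"
      by (simp only: energy[OF x(1)] mult.assoc)
    then have "sqrt ((v x)\<^sup>2) = sqrt (2 * l / r) * sqrt (M powr r) * sqrt (1 - ?s powr r)"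
      by (simp only: real_sqrt_mult)
    also have "sqrt (M powr r) = M powr ((p - 1) / 2) * M"
    proof -
      have "sqrt (M powr r) = M powr (r * (1 / 2))"
        by (simp only: powr_half_sqrt[symmetric] powr_ge_zero powr_powr)
      also have "r * (1 / 2) = (p - 1) / 2 + 1" by (simp add: r_def field_simps)
      finally show ?thesis using M by (simp add: powr_add)
    qed
    finally have "\<bar>v x\<bar> = \<kappa> * M * sqrt (1 - ?s powr r)" by (simp add: \<kappa>_def)
    then have v: "v x = sgn (v x) * \<kappa> * M * sqrt (1 - ?s powr r)"
      by (metis mult.assoc sgn_mult_abs)
    have "(T has_real_derivative 1 / sqrt (1 - ?s powr r) * (v x / M)) (at x)"
      unfolding T_def[abs_def]
      by (rule DERIV_chain2[where f = "gen_arcsin r" and g = "\<lambda>x. u x / M"])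
        (use r s du[OF x(1)] in \<open>auto intro!: has_real_derivative_gen_arcsin DERIV_cdivide\<close>)
    also have "1 / sqrt (1 - ?s powr r) * (v x / M) = sgn (v x) * \<kappa>"
      by (subst v) (use lt M in simp)
    finally show ?thesis .
  qed
  have T_bd: "T (-1) = 0" "T 1 = 0" and T0: "T x0 = A"
    using bd M by (simp_all add: T_def A_def M_def)
  have left: "T x = \<kappa> * (x + 1)" if x: "x \<in> {-1..x0}" for x
  proof -
    have "((\<lambda>_. \<kappa>) has_integral T x - T (-1)) {-1..x}"
    proof (rule fundamental_theorem_of_calculus_interior[where f = T])
      show "(T has_vector_derivative \<kappa>) (at y)" if "y \<in> {-1<..<x}" for y
        using dT[of y] v_pos[of y] that x x0I by (auto simp: has_real_derivative_iff_has_vector_derivative)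
      show "continuous_on {-1..x} T" using x x0I by (intro continuous_on_subset[OF T_cont]) auto
    qed (use x in auto)
    from has_integral_unique[OF has_integral_const_real[of \<kappa> "-1" x] this]
    show ?thesis using x T_bd by (simp add: algebra_simps)
  qed
  have right: "T x = \<kappa> * (1 - x)" if x: "x \<in> {x0..1}" for x
  proof -
    have "((\<lambda>_. - \<kappa>) has_integral T 1 - T x) {x..1}"
    proof (rule fundamental_theorem_of_calculus_interior[where f = T])
      show "(T has_vector_derivative - \<kappa>) (at y)" if "y \<in> {x<..<1}" for y
        using dT[of y] v_neg[of y] that x x0I by (auto simp: has_real_derivative_iff_has_vector_derivative)
      show "continuous_on {x..1} T" using x x0I by (intro continuous_on_subset[OF T_cont]) auto
    qed (use x in auto)
    from has_integral_unique[OF has_integral_const_real[of "- \<kappa>" x 1] this]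
    show ?thesis using x T_bd by (simp add: algebra_simps)
  qed
  have \<kappa>x0: "\<kappa> * (x0 + 1) = A" "\<kappa> * (1 - x0) = A"
    using left[of x0] right[of x0] T0 x0(1) by auto
  \<comment> \<open>Equal heights with equal speeds force equal distances to the two endpoints;
    \<kappa> is nonzero because \<open>A\<close> is positive.\<close>
  then have "\<kappa> * x0 = 0" unfolding distrib_left right_diff_distrib by linarith
  with \<kappa>x0 have x00: "x0 = 0" and \<kappa>: "\<kappa> = A" using A by auto
  have "u x = M * profile r x" if x: "x \<in> {-1..1}" for x
  proof -
    have "T x = A * (1 - \<bar>x\<bar>)"
      using left[of x] right[of x] x by (cases "x \<le> 0") (auto simp: x00 \<kappa> add.commute)
    then have "profile r x = u x / M"
      using uM[OF x] x r by (intro profile_eqI) (auto simp: T_def A_def)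
    then show ?thesis using M by simp
  qed
  then show thesis
    using that[of M] M \<kappa> by (simp add: \<kappa>_def A_def r_def)
qed

section \<open>The formulas for the first eigenvalue and the first eigenfunction\<close>

theorem theorem1p5:
  fixes p :: real
  assumes "p > 1"
  shows "mu1 p = 2 powr ((p - 3) / 2) * (p + 1) * A_const p powr ((p + 3) / 2)
                 * B_const p powr ((p - 1) / 2) \<and>
         (\<forall>\<phi> W. first_eigenfunction p \<phi> \<longrightarrow> W_solution p W \<longrightarrow>
            (\<forall>x\<in>interval_I.
               \<phi> x = 2 powr (2 / (p\<^sup>2 - 1)) * (p + 1) powr (- 1 / (p - 1))
                     * A_const p powr (- (p + 3) / (p\<^sup>2 - 1))
                     * C_const p powr (- 1 / (p + 1)) * W x))"
proof (intro conjI allI impI ballI)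
  note p = assms
  show "mu1 p = 2 powr ((p - 3) / 2) * (p + 1) * A_const p powr ((p + 3) / 2)
                 * B_const p powr ((p - 1) / 2)"
    using mu1_eq_best_const[OF p] best_const_eq[OF p] by simp
  fix \<phi> W x
  assume \<phi>: "first_eigenfunction p \<phi>" and W: "W_solution p W" and x: "x \<in> interval_I"
  define r where "r = p + 1"
  define A where "A = A_const p"
  define C where "C = C_const p"
  have r: "r \<ge> 1" "r > 2" using p by (auto simp: r_def)
  have A_eq: "A = gen_arcsin r 1" using A_const_eq_gen_arcsin[OF p] by (simp add: A_def r_def)
  have A: "A > 0" using gen_arcsin_1_pos[OF r(1)] by (simp add: A_eq)
  have C_eq: "C = 2 * A / (r + 2)"
  proof -
    have "area r 1 = r * A / (r + 2)"
      using arcsin_area_relation[OF r(1)] r by (simp add: A_eq field_simps)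
    then have "C = A - r * A / (r + 2)" using C_const_eq[OF p] by (simp add: C_def r_def A_eq)
    also have "\<dots> = 2 * A / (r + 2)" using r by (simp add: field_simps)
    finally show ?thesis .
  qed
  then have C: "C > 0" using A r by simp

  \<comment> \<open>For a fixed solution the nonlocal factor is just a number. It is nonzero by the
    equation at 0, so dividing by it leaves the local problem with
    \<open>l = mu1 p / N\<close>.\<close>
  define N where "N = L2_norm_I (deriv \<phi>) powr (p - 1)"
  have es: "eigen_solution p (mu1 p) \<phi>" using \<phi> by (simp add: first_eigenfunction_def)
  have pd: "positive_dirichlet \<phi>" and mu: "mu1 p > 0"
    and eq: "\<And>x. x \<in> interval_I \<Longrightarrow> - N * deriv (deriv \<phi>) x = mu1 p * \<phi> x powr p"
    using es by (auto simp: eigen_solution_def N_def)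
  have "\<phi> 0 > 0" using pd by (simp add: positive_dirichlet_def)
  then have "N \<noteq> 0" using eq[of 0] mu by auto
  then have N: "N > 0" by (simp add: N_def)
  obtain M where M: "M > 0" "\<And>x. x \<in> {-1..1} \<Longrightarrow> \<phi> x = M * profile r x"
  proof (rule positive_solution_eq_profile[OF p _ pd, of "mu1 p / N"])
    show "mu1 p / N > 0" using mu N by simp
    show "deriv (deriv \<phi>) x = - (mu1 p / N) * \<phi> x powr p" if "x \<in> interval_I" for x
      using eq[OF that] N by (simp add: field_simps)
  qed (use that in \<open>auto simp: r_def\<close>)
  obtain K where K: "K > 0" "sqrt (2 / r) * K powr ((p - 1) / 2) = A"
    "\<And>x. x \<in> {-1..1} \<Longrightarrow> W x = K * profile r x"
  proof (rule positive_solution_eq_profile[OF p, of 1 W])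
    show "positive_dirichlet W" using W by (simp add: W_solution_def)
    show "deriv (deriv W) x = - 1 * W x powr p" if "x \<in> interval_I" for x
    proof -
      have "- deriv (deriv W) x = W x powr p" using W that unfolding W_solution_def by blast
      then show ?thesis by simp
    qed
  qed (use that in \<open>auto simp: r_def A_eq\<close>)

  \<comment> \<open>The normalization fixes the amplitude \<open>M\<close>; the integral
    \<open>4 / (r + 2)\<close> of the profile power is expressed through \<open>C\<close> and
    \<open>A\<close>.\<close>
  have "1 = (LINT x|meas_I. \<phi> x powr r)"
    using \<phi> by (simp add: first_eigenfunction_def r_def)
  also have "\<dots> = (LINT x|meas_I. M powr r * profile r x powr r)"
  proof (rule Bochner_Integration.integral_cong)
    fix x :: real assume "x \<in> space meas_I"
    then show "\<phi> x powr r = M powr r * profile r x powr r"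
      using M profile_in[OF r(1), of x] by (auto simp: powr_mult)
  qed simp
  also have "\<dots> = M powr r * integral {-1..1} (\<lambda>x. profile r x powr r)"
  proof -
    have "continuous_on {-1..1} (\<lambda>x. profile r x powr r)"
      using profile_in[OF r(1)] r by (intro continuous_on_powr' continuous_on_profile) auto
    then show ?thesis using LINT_open_interval_continuous by simp
  qed
  also have "\<dots> = M powr r * (4 / (r + 2))" by (simp add: integral_profile_powr[OF r(1)])
  also have "4 / (r + 2) = 2 * C / A" using A by (simp add: C_eq)
  finally have Mr: "M powr r = (2 * C / A) powr (- 1)"
    using A C by (simp add: powr_neg_one field_simps)
  have "M = (M powr r) powr (1 / r)" using M(1) r by (simp add: powr_powr)
  also have "\<dots> = (2 * C / A) powr (- 1 * (1 / r))" unfolding Mr by (simp only: powr_powr)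
  finally have M_eq: "M = (2 * C / A) powr (- 1 / r)" by simp

  \<comment> \<open>The amplitude relation for \<open>l = 1\<close>, solved for
    \<open>K\<close>.\<close>
  have "K powr ((p - 1) / 2) = A * (r / 2) powr (1 / 2)"
  proof -
    have "sqrt (2 / r) * (r / 2) powr (1 / 2) = 1"
      using r by (simp add: powr_half_sqrt real_sqrt_mult[symmetric])
    then have "K powr ((p - 1) / 2) = sqrt (2 / r) * (r / 2) powr (1 / 2) * K powr ((p - 1) / 2)"
      by simp
    then show ?thesis unfolding K(2)[symmetric] by (simp only: mult_ac)
  qed
  then have "(K powr ((p - 1) / 2)) powr (2 / (p - 1)) = (A * (r / 2) powr (1 / 2)) powr (2 / (p - 1))"
    by (rule arg_cong)
  also have "(K powr ((p - 1) / 2)) powr (2 / (p - 1)) = K"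
  proof -
    have "(p - 1) / 2 * (2 / (p - 1)) = 1" using p by simp
    then show ?thesis using K(1) by (simp only: powr_powr) simp
  qed
  also have "(A * (r / 2) powr (1 / 2)) powr (2 / (p - 1)) =
      A powr (2 / (p - 1)) * (r / 2) powr (1 / 2 * (2 / (p - 1)))"
    using A by (simp only: powr_mult powr_powr)
  also have "1 / 2 * (2 / (p - 1)) = 1 / (p - 1)" by simp
  finally have K_eq: "K = A powr (2 / (p - 1)) * (r powr (1 / (p - 1)) / 2 powr (1 / (p - 1)))"
    using r by (simp add: powr_divide)

  have q: "p\<^sup>2 - 1 = (p - 1) * (p + 1)" by (simp add: power2_eq_square algebra_simps)
  \<comment> \<open>Partial fractions split the exponents of 2 and \<open>A\<close> in the claim
    into the contributions of \<open>M\<close> and of \<open>1 / K\<close>.\<close>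
  have "1 / (p - 1) - 1 / (p + 1) = ((p + 1) - (p - 1)) / ((p - 1) * (p + 1))"
    using p by (simp add: diff_frac_eq)
  then have e2: "2 / (p\<^sup>2 - 1) = 1 / (p - 1) - 1 / r"
    unfolding q r_def by simp
  have "1 / (p + 1) - 2 / (p - 1) = ((p - 1) - 2 * (p + 1)) / ((p - 1) * (p + 1))"
    using p by (simp add: diff_frac_eq mult.commute)
  also have "(p - 1) - 2 * (p + 1) = - (p + 3)" by simp
  finally have eA: "- (p + 3) / (p\<^sup>2 - 1) = 1 / r - 2 / (p - 1)"
    unfolding q r_def by simp
  have neg: "t powr (- 1 / s) = 1 / t powr (1 / s)" for s t :: real
    by (simp add: powr_minus_divide)
  have "M / K = 2 powr (1 / (p - 1) - 1 / r) * r powr (- 1 / (p - 1))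
      * A powr (1 / r - 2 / (p - 1)) * C powr (- 1 / r)"
    unfolding M_eq K_eq neg powr_diff
    using A C by (simp add: powr_mult powr_divide mult_ac)
  moreover have "\<phi> x = M / K * W x"
    using M(2)[of x] K(3)[of x] K(1) x by simp
  ultimately show "\<phi> x = 2 powr (2 / (p\<^sup>2 - 1)) * (p + 1) powr (- 1 / (p - 1))
                     * A_const p powr (- (p + 3) / (p\<^sup>2 - 1))
                     * C_const p powr (- 1 / (p + 1)) * W x"
    unfolding e2 eA A_def C_def r_def by simp
qed

end
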